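(* Let $A$ be a finite element system on a cellular complex $\mathcal T$, and suppose that $A$ admits extensions on $\mathcal T$. Then $A$ is compatible if and only if the following two conditions hold: (1) for each $T\in\mathcal T$ the ("inclusion of constants") map $\mathsf c_T:\mathbb R\to A^0(T)$ is injective; (2) for each $T\in\mathcal T$ the complex $A_0^\bullet(T)$ has nontrivial cohomology only at index $k=\dim T$, and there the map induced by evaluation, $\mathsf e_T: \mathrm H^k A_0^\bullet(T)\to\mathbb R$, is an isomorphism.
   Context: $\mathcal T$ is a cellular complex; $T'\unlhd T$ means that $T'$ is a subcell of $T$ ($T$ itself included). $\mathrm o(T,T')\in\{0,\pm1\}$ denotes relative orientation: it is $\pm1$ if $T'$ is a codimension-one subcell of $T$ and $0$ otherwise. A finite element system $A$ on $\mathcal T$ consists of: - vector spaces $A^k(T)$, for $T\in\mathcal T$, $k\in\mathbb Z$, with $A^k(T)=0$ for $k<0$; - differentials $\mathsf d_T^k:A^k(T)\to A^{k+1}(T)$ with $\mathsf d_T^{k+1}\mathsf d_T^k=0$; - for $T'\unlhd T$, restriction maps $\mathsf r^k_{T'T}:A^k(T)\to A^k(T')$ that commute with the differentials, $\mathsf r^{k+1}_{T'T}\mathsf d^k_T=\mathsf d^k_{T'}\mathsf r^k_{T'T}$, and satisfy $\mathsf r^k_{T''T}=\mathsf r^k_{T''T'}\mathsf r^k_{T'T}$ for $T''\unlhd T'\unlhd T$, so that the $A^\bullet(T)$ form an inverse system of complexes; - maps $\mathsf c_T:\mathbb R\to A^0(T)$ (mimicking the inclusion of constant functions) with $\mathsf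 d^0_T\mathsf c_T=0$ and $\mathsf r_{T'T}\mathsf c_T=\mathsf c_{T'}$ for $T'\unlhd T$; - for each $k$-dimensional cell $T$, an evaluation map $\mathsf e_T:A^k(T)\to\mathbb R$ (mimicking integration of $k$-forms on a $k$-cell) such that for all $u\in A^{k-1}(T)$, $\mathsf e_T\mathsf d_Tu=\sum_{T'\in\partial T}\mathrm o(T,T')\,\mathsf e_{T'}\mathsf r_{T'T}u$ (only codimension-one subcells contribute). All maps are linear. For a cell $T$, $\partial T$ denotes the cellular complex of strict subcells of $T$ (empty if $T$ is a point), and $A^k(\partial T)$ is the space of families $(u_{T'})_{T'\in\partial T}$ with $u_{T'}\in A^k(T')$ and $u_{T''}=\mathsf r_{T''T'}u_{T'}$ whenever $T''\unlhd T'$. $A_0^k(T)$ is the kernel of the restriction map $A^k(T)\to A^k(\partial T)$; so $A^k_0(T)=A^k(T)$ if $T$ is a point. By the Stokes-type formula, $\mathsf e_T$ is well defined on $\mathrm H^kA_0^\bullet(T)$ for $k=\dim T$. $A$ admits extensions on $\mathcal T$ if for each $T\in\mathcal T$ and each $k$ the restriction $A^k(T)\to A^k(\partial T)$ is surjective. $A$ is locally exact if for each $T\in\mathcal T$ the sequence $0\to\mathbb R\xrightarrow{\mathsf c_T}A^0(T)\xrightarrow{\mathsf d}A^1(T)\xrightarrow{\mathsf d}\cdots$ is exact. $A$ is compatible if it admits extensions and is locally exact.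
   Formalization: Adds the assumption that for each point T the evaluation e_T of the constant c_T(1) is nonzero; without it "only if" fails (single point, A^0(T)=R, c_T=id, e_T=0). Conditions (1) and (2) imply it. *)

theory Defs
  imports "HOL-Homology.Homology"
begin

section \<open>Cellular complexes\<close>

definition unit_disc :: "nat \<Rightarrow> (nat \<Rightarrow> real) set" where
  "unit_disc k = {x \<in> topspace (Euclidean_space k). (\<Sum>i<k. (x i)\<^sup>2) \<le> 1}"

definition unit_sphere :: "nat \<Rightarrow> (nat \<Rightarrow> real) set" where
  "unit_sphere k = {x \<in> topspace (Euclidean_space k). (\<Sum>i<k. (x i)\<^sup>2) = 1}"

text \<open>A closed \<open>k\<close>-cell \<open>T\<close> with boundary \<open>B\<close>. For \<open>k = 0\<close> the disc is a point and the
  sphere \<open>unit_sphere 0\<close> is empty.\<close>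

definition is_cell :: "'p topology \<Rightarrow> nat \<Rightarrow> 'p set \<Rightarrow> 'p set \<Rightarrow> bool" where
  "is_cell X k T B \<longleftrightarrow> T \<subseteq> topspace X \<and>
     (\<exists>h. homeomorphic_map (subtopology (Euclidean_space k) (unit_disc k)) (subtopology X T) h \<and>
          h ` unit_sphere k = B)"

record 'p cell_cplx =
  space_of :: "'p topology"
  cells :: "'p set set"
  cdim :: "'p set \<Rightarrow> nat"
  bdry :: "'p set \<Rightarrow> 'p set"
  orient :: "'p set \<Rightarrow> 'p set \<Rightarrow> int"

definition subcell :: "'p cell_cplx \<Rightarrow> 'p set \<Rightarrow> 'p set \<Rightarrow> bool" where
  "subcell K T' T \<longleftrightarrow> T' \<in> cells K \<and> T \<in> cells K \<and> T' \<subseteq> T"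

definition strict_subcells :: "'p cell_cplx \<Rightarrow> 'p set \<Rightarrow> 'p set set" where
  "strict_subcells K T = {T'. subcell K T' T \<and> T' \<noteq> T}"

text \<open>The topological part of the definition is that of a regular cell complex. The complex may be
  infinite, as long as every cell has finitely many subcells.\<close>

definition regular_cells :: "'p cell_cplx \<Rightarrow> bool" where
  "regular_cells K \<longleftrightarrow>
     Hausdorff_space (space_of K) \<and>
     \<Union>(cells K) = topspace (space_of K) \<and>
     (\<forall>T\<in>cells K. is_cell (space_of K) (cdim K T) T (bdry K T)) \<and>
     (\<forall>T\<in>cells K. \<forall>T'\<in>cells K. T \<noteq> T' \<longrightarrow> (T - bdry K T) \<inter> (T' - bdry K T') = {}) \<and>
     (\<forall>T\<in>cells K. \<exists>F \<subseteq> {T' \<in> cells K. cdim K T' < cdim K T}. bdry K T = \<Union>F) \<and>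
     (\<forall>T\<in>cells K. finite (strict_subcells K T))"

text \<open>Relative orientations enter as an incidence function in the usual sense for regular cell
  complexes. The last condition says that the endpoints of an edge have opposite signs (points
  carry their canonical orientation), the third one that the cellular boundary operator squares
  to zero. The incidence functions are exactly the relative orientations induced by a choice of
  orientation of every cell of positive dimension.\<close>

definition relative_orientation :: "'p cell_cplx \<Rightarrow> bool" where
  "relative_orientation K \<longleftrightarrow>
     (\<forall>T\<in>cells K. \<forall>T'\<in>cells K.
        subcell K T' T \<and> cdim K T = Suc (cdim K T') \<longrightarrow> orient K T T' \<in> {1, -1}) \<and>
     (\<forall>T\<in>cells K. \<forall>T'\<in>cells K.
        \<not> (subcell K T' T \<and> cdim K T = Suc (cdim K T')) \<longrightarrow> orient K T T' = 0) \<and>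
     (\<forall>T\<in>cells K. \<forall>T''\<in>cells K.
        (\<Sum>T'\<in>strict_subcells K T. orient K T T' * orient K T' T'') = 0) \<and>
     (\<forall>T\<in>cells K. cdim K T = 1 \<longrightarrow> (\<Sum>T'\<in>strict_subcells K T. orient K T T') = 0)"

definition cellular_complex :: "'p cell_cplx \<Rightarrow> bool" where
  "cellular_complex K \<longleftrightarrow> regular_cells K \<and> relative_orientation K"


section \<open>Finite element systems\<close>

definition linear_map_on :: "'a::real_vector set \<Rightarrow> 'b::real_vector set \<Rightarrow> ('a \<Rightarrow> 'b) \<Rightarrow> bool" where
  "linear_map_on V W f \<longleftrightarrow> f ` V \<subseteq> W \<and>
     (\<forall>x\<in>V. \<forall>y\<in>V. f (x + y) = f x + f y) \<and> (\<forall>a. \<forall>x\<in>V. f (a *\<^sub>R x) = a *\<^sub>R f x)"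

text \<open>All spaces \<open>A\<^sup>k(T)\<close> are subspaces of one ambient space \<open>'v\<close>; since \<open>'v\<close> is arbitrary (e.g. a
  direct sum) this is no restriction. Maps are only constrained on the relevant subspaces.
  \<open>restr A T' T k\<close> is the restriction from \<open>A\<^sup>k(T)\<close> to \<open>A\<^sup>k(T')\<close>.\<close>

record ('p, 'v) fe_system =
  sp :: "'p set \<Rightarrow> int \<Rightarrow> 'v set"
  diff :: "'p set \<Rightarrow> int \<Rightarrow> 'v \<Rightarrow> 'v"
  restr :: "'p set \<Rightarrow> 'p set \<Rightarrow> int \<Rightarrow> 'v \<Rightarrow> 'v"
  const :: "'p set \<Rightarrow> real \<Rightarrow> 'v"
  eval :: "'p set \<Rightarrow> 'v \<Rightarrow> real"

definition system_of_complexes ::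
  "'p cell_cplx \<Rightarrow> ('p, 'v::real_vector) fe_system \<Rightarrow> bool" where
  "system_of_complexes K A \<longleftrightarrow>
     (\<forall>T\<in>cells K. \<forall>k. subspace (sp A T k)) \<and>
     (\<forall>T\<in>cells K. \<forall>k<0. sp A T k = {0}) \<and>
     (\<forall>T\<in>cells K. \<forall>k. linear_map_on (sp A T k) (sp A T (k + 1)) (diff A T k)) \<and>
     (\<forall>T\<in>cells K. \<forall>k. \<forall>u\<in>sp A T k. diff A T (k + 1) (diff A T k u) = 0) \<and>
     (\<forall>T T' k. subcell K T' T \<longrightarrow> linear_map_on (sp A T k) (sp A T' k) (restr A T' T k)) \<and>
     (\<forall>T T' k. subcell K T' T \<longrightarrow> (\<forall>u\<in>sp A T k.
        restr A T' T (k + 1) (diff A T k u) = diff A T' k (restr A T' T k u))) \<and>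
     (\<forall>T\<in>cells K. \<forall>k. \<forall>u\<in>sp A T k. restr A T T k u = u) \<and>
     (\<forall>T T' T'' k. subcell K T'' T' \<and> subcell K T' T \<longrightarrow> (\<forall>u\<in>sp A T k.
        restr A T'' T k u = restr A T'' T' k (restr A T' T k u)))"

definition constants_maps ::
  "'p cell_cplx \<Rightarrow> ('p, 'v::real_vector) fe_system \<Rightarrow> bool" where
  "constants_maps K A \<longleftrightarrow>
     (\<forall>T\<in>cells K. linear_map_on UNIV (sp A T 0) (const A T)) \<and>
     (\<forall>T\<in>cells K. \<forall>a. diff A T 0 (const A T a) = 0) \<and>
     (\<forall>T T'. subcell K T' T \<longrightarrow> (\<forall>a. restr A T' T 0 (const A T a) = const A T' a))"

definition evaluation_maps ::
  "'p cell_cplx \<Rightarrow> ('p, 'v::real_vector) fe_system \<Rightarrow> bool" where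
  "evaluation_maps K A \<longleftrightarrow>
     (\<forall>T\<in>cells K. linear_map_on (sp A T (int (cdim K T))) UNIV (eval A T)) \<and>
     (\<forall>T\<in>cells K. \<forall>k. k = int (cdim K T) \<longrightarrow> (\<forall>u\<in>sp A T (k - 1).
        eval A T (diff A T (k - 1) u) =
          (\<Sum>T'\<in>strict_subcells K T. of_int (orient K T T') * eval A T' (restr A T' T (k - 1) u))))"

definition finite_element_system ::
  "'p cell_cplx \<Rightarrow> ('p, 'v::real_vector) fe_system \<Rightarrow> bool" where
  "finite_element_system K A \<longleftrightarrow>
     system_of_complexes K A \<and> constants_maps K A \<and> evaluation_maps K A"


section \<open>Extensions, exactness and compatibility\<close>

definition bdry_sp :: "'p cell_cplx \<Rightarrow> ('p, 'v) fe_system \<Rightarrow> 'p set \<Rightarrow> int \<Rightarrow> ('p set \<Rightarrow> 'v) set" where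
  "bdry_sp K A T k =
     {u \<in> (\<Pi>\<^sub>E T'\<in>strict_subcells K T. sp A T' k).
        \<forall>T'\<in>strict_subcells K T. \<forall>T''. subcell K T'' T' \<longrightarrow> u T'' = restr A T'' T' k (u T')}"

definition bdry_restr ::
  "'p cell_cplx \<Rightarrow> ('p, 'v) fe_system \<Rightarrow> 'p set \<Rightarrow> int \<Rightarrow> 'v \<Rightarrow> 'p set \<Rightarrow> 'v" where
  "bdry_restr K A T k u = (\<lambda>T'\<in>strict_subcells K T. restr A T' T k u)"

definition sp0 :: "'p cell_cplx \<Rightarrow> ('p, 'v::zero) fe_system \<Rightarrow> 'p set \<Rightarrow> int \<Rightarrow> 'v set" where
  "sp0 K A T k = {u \<in> sp A T k. bdry_restr K A T k u = (\<lambda>T'\<in>strict_subcells K T. 0)}"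

definition admits_extensions :: "'p cell_cplx \<Rightarrow> ('p, 'v) fe_system \<Rightarrow> bool" where
  "admits_extensions K A \<longleftrightarrow>
     (\<forall>T\<in>cells K. \<forall>k. bdry_restr K A T k ` sp A T k = bdry_sp K A T k)"

definition locally_exact :: "'p cell_cplx \<Rightarrow> ('p, 'v::zero) fe_system \<Rightarrow> bool" where
  "locally_exact K A \<longleftrightarrow> (\<forall>T\<in>cells K.
     inj (const A T) \<and>
     range (const A T) = {u \<in> sp A T 0. diff A T 0 u = 0} \<and>
     (\<forall>k\<ge>0. diff A T k ` sp A T k = {u \<in> sp A T (k + 1). diff A T (k + 1) u = 0}))"

definition compatible :: "'p cell_cplx \<Rightarrow> ('p, 'v::zero) fe_system \<Rightarrow> bool" where
  "compatible K A \<longleftrightarrow> admits_extensions K A \<and> locally_exact K A"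


section \<open>Cohomology of the complex with vanishing boundary restriction\<close>

definition cocycles0 :: "'p cell_cplx \<Rightarrow> ('p, 'v::zero) fe_system \<Rightarrow> 'p set \<Rightarrow> int \<Rightarrow> 'v set" where
  "cocycles0 K A T k = {u \<in> sp0 K A T k. diff A T k u = 0}"

definition coboundaries0 :: "'p cell_cplx \<Rightarrow> ('p, 'v::zero) fe_system \<Rightarrow> 'p set \<Rightarrow> int \<Rightarrow> 'v set" where
  "coboundaries0 K A T k = diff A T (k - 1) ` sp0 K A T (k - 1)"

definition cohomology0 ::
  "'p cell_cplx \<Rightarrow> ('p, 'v::real_vector) fe_system \<Rightarrow> 'p set \<Rightarrow> int \<Rightarrow> 'v set set" where
  "cohomology0 K A T k = cocycles0 K A T k //
     {(x, y). x \<in> cocycles0 K A T k \<and> y \<in> cocycles0 K A T k \<and> x - y \<in> coboundaries0 K A T k}"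

text \<open>The zero class is \<open>coboundaries0 K A T k\<close> itself. By the Stokes formula \<open>eval A T\<close> is constant
  on each class in degree \<open>cdim K T\<close>, so that \<open>the_elem\<close> extracts a genuine value. The induced map
  is automatically linear, so it is an isomorphism iff it is bijective.\<close>

definition eval_cohomology0 :: "('p, 'v) fe_system \<Rightarrow> 'p set \<Rightarrow> 'v set \<Rightarrow> real" where
  "eval_cohomology0 A T C = the_elem (eval A T ` C)"

definition cohomology_condition ::
  "'p cell_cplx \<Rightarrow> ('p, 'v::real_vector) fe_system \<Rightarrow> 'p set \<Rightarrow> bool" where
  "cohomology_condition K A T \<longleftrightarrow>
     (\<forall>k. k \<noteq> int (cdim K T) \<longrightarrow> cohomology0 K A T k = {coboundaries0 K A T k}) \<and>
     bij_betw (eval_cohomology0 A T) (cohomology0 K A T (int (cdim K T))) UNIV"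

text \<open>Nothing in \<open>finite_element_system\<close> relates \<open>eval\<close> to \<open>const\<close> on points; the normalization below
  excludes e.g. \<open>eval = 0\<close>. It holds in particular if evaluation at a point sends the constant
  \<open>a\<close> to \<open>a\<close>.\<close>

definition nondegenerate_at_points :: "'p cell_cplx \<Rightarrow> ('p, 'v) fe_system \<Rightarrow> bool" where
  "nondegenerate_at_points K A \<longleftrightarrow>
     (\<forall>T\<in>cells K. cdim K T = 0 \<longrightarrow> eval A T (const A T 1) \<noteq> 0)"

end

theory Submission
  imports Defs
begin

text \<open>
  Write \<open>C(L)\<close> for the real cellular cochain complex of a finite set \<open>L\<close> of cells that contains all
  subcells of its members, with the coboundary given by the relative orientations, and \<open>A(L)\<close> for the
  complex of compatible families over \<open>L\<close>. Evaluation on each cell is, by the Stokes formula, a cochain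
  map from \<open>A(L)\<close> to \<open>C(L)\<close>, the de Rham map. The theorem compares the two complexes, and rests on two
  independent facts.

  The topological fact is that \<open>C(T)\<close> computes the cohomology of a point for each closed cell \<open>T\<close>
  (\<open>cocycle_is_coboundary\<close>, \<open>cocycle_constant\<close>). Since cells are contractible, every cell \<open>T\<close> can be
  represented by a singular chain inside \<open>T\<close> in such a way that cellular chains map to singular chains
  (\<open>cell_simplex\<close>). By induction on the number of cells this map is a homology isomorphism for every
  finite subcomplex (\<open>comparison_downclosed\<close>): adding a cell \<open>T\<close> does not change the statement because the
  pairs \<open>(T, \<partial>T)\<close> and \<open>(L \<union> T, L)\<close> have the same relative homology, by excision and a radial collapse.
  The induction also yields the acyclicity of \<open>T\<close> (\<open>acyclic_if_comparison_boundary\<close>): the cellular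
  chains of \<open>\<partial>T\<close> have the homology of a sphere, and the boundary of \<open>T\<close> is a generator of the top
  homology because it is a cycle all of whose coefficients are \<open>\<plusminus>1\<close>. So the relative
  orientations enter only through their formal properties. A contraction of the integral chains passes
  acyclicity on to real cochains.

  The algebraic fact is that, when extensions exist, \<open>0 \<rightarrow> A\<^sub>0(T) \<rightarrow> A(L \<union> T) \<rightarrow> A(L) \<rightarrow> 0\<close> is exact, and it
  lies over the corresponding sequence of cochains, whose kernel is a single \<open>\<real>\<close> in degree \<open>dim T\<close>.
  Condition (2) for \<open>T\<close> says exactly that the map of kernels is a quasi-isomorphism
  (\<open>cohomology_condition_iff\<close>). So if (2) holds for all cells, the de Rham map is a quasi-isomorphism for
  every \<open>L\<close> (\<open>de_rham_downclosed\<close>); and if it is one for \<open>T\<close> and for \<open>\<partial>T\<close>, then (2) holds for \<open>T\<close>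
  (\<open>de_rham0_if_de_rham\<close>). Finally, for a single closed cell, both complexes are augmented by the
  constants, whose evaluations at points are nonzero, and \<open>C(T)\<close> is exact. So for injective \<open>c\<^sub>T\<close> the de
  Rham map of \<open>T\<close> is a quasi-isomorphism if and only if \<open>A(T)\<close> is exact (\<open>de_rham_if_exact\<close>, \<open>exact_if_de_rham\<close>).

  All quasi-isomorphisms are stated as exactness of the mapping cone, that is, as one condition on
  pairs of elements. The five lemma then becomes a direct chase, with no quotients.
\<close>

section \<open>Reduced cycles in singular homology\<close>

definition augmentation :: "('a \<Rightarrow>\<^sub>0 int) \<Rightarrow> int" where
  "augmentation c = (\<Sum>i\<in>Poly_Mapping.keys c. Poly_Mapping.lookup c i)"

lemma frag_extend_const: "frag_extend (\<lambda>_. x) c = frag_cmul (augmentation c) x"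
proof -
  have "(\<Sum>i\<in>I. frag_cmul (g i) x) = frag_cmul (\<Sum>i\<in>I. g i) x" for I and g :: "_ \<Rightarrow> int"
    by (induction I rule: infinite_finite_induct) (simp_all add: frag_cmul_distrib)
  then show ?thesis
    by (simp add: frag_extend_def augmentation_def)
qed

text \<open>In this form the augmentation inherits linearity from \<open>frag_extend\<close>.\<close>
lemma augmentation_eq: "augmentation c = Poly_Mapping.lookup (frag_extend (\<lambda>_. frag_of ()) c) ()"
  by (simp add: frag_extend_const)

lemma augmentation_simps [simp]:
  "augmentation 0 = 0" "augmentation (frag_of x) = 1" "augmentation (a + b) = augmentation a + augmentation b" "augmentation (a - b) = augmentation a - augmentation b"
  "augmentation (- a) = - augmentation a" "augmentation (frag_cmul k a) = k * augmentation a"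
  by (simp_all add: augmentation_eq frag_extend_add frag_extend_diff frag_extend_minus frag_extend_cmul
      lookup_add lookup_minus)

lemma augmentation_sum: "augmentation (sum f I) = (\<Sum>i\<in>I. augmentation (f i))"
  by (induction I rule: infinite_finite_induct) simp_all

lemma augmentation_frag_extend:
  assumes "\<And>x. x \<in> Poly_Mapping.keys c \<Longrightarrow> augmentation (f x) = m"
  shows "augmentation (frag_extend f c) = augmentation c * m"
  using assms by (simp add: frag_extend_def augmentation_sum augmentation_def[of c] sum_distrib_right)

lemma augmentation_chain_boundary_1: "augmentation (chain_boundary (Suc 0) c) = 0"
proof -
  have "augmentation (chain_boundary (Suc 0) c) = augmentation c * 0"
    unfolding chain_boundary_def by (simp, subst augmentation_frag_extend) (auto simp: augmentation_sum)
  then show ?thesis by simp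
qed

text \<open>Cycles that represent classes of reduced homology. Together with \<open>bounds\<close> below this expresses
  the computations of reduced homology groups in terms of chains, where they can be combined with
  cellular chains.\<close>
definition reduced_cycle :: "nat \<Rightarrow> 'a topology \<Rightarrow> 'a chain \<Rightarrow> bool" where
  "reduced_cycle p X c \<longleftrightarrow>
     singular_chain p X c \<and> chain_boundary p c = 0 \<and> (p = 0 \<longrightarrow> augmentation c = 0)"

definition bounds :: "nat \<Rightarrow> 'a topology \<Rightarrow> 'a chain \<Rightarrow> bool" where
  "bounds p X c \<longleftrightarrow> (\<exists>d. singular_chain (Suc p) X d \<and> chain_boundary (Suc p) d = c)"

lemma bounds_iff_relboundary: "bounds p X c \<longleftrightarrow> singular_relboundary p X {} c"
  by (simp add: bounds_def singular_boundary)

text \<open>In degree 0 the class of \<open>c\<close> maps to the homology of a point. There \<open>c\<close> becomes its augmentation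
  times the only simplex, and \<open>0\<close> is the only boundary.\<close>
lemma reduced_cycle_iff_class:
  fixes X :: "'a topology"
  assumes "singular_relcycle p X {} c"
  shows "reduced_cycle p X c \<longleftrightarrow>
           homologous_rel_set p X {} c \<in> carrier (reduced_homology_group (int p) X)"
proof (cases "p = 0")
  case False
  then show ?thesis
    using assms carrier_relative_homology_group[of p X "{}"]
    by (auto simp: reduced_cycle_def un_reduced_homology_group singular_cycle)
next
  case True
  let ?pt = "discrete_topology {()}"
  have c: "singular_chain 0 X c"
    using assms True by (simp add: singular_cycle)
  have "frag_of \<circ> simplex_map 0 (\<lambda>x::'a. ())
      = (\<lambda>_. frag_of (restrict (\<lambda>x. ()) (standard_simplex 0)))"
    by (simp add: simplex_map_def o_def)
  then have cm: "chain_map 0 (\<lambda>x. ()) c =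
      frag_cmul (augmentation c) (frag_of (restrict (\<lambda>x. ()) (standard_simplex 0)))"
    by (simp only: chain_map_def frag_extend_const)
  have "hom_induced 0 X {} ?pt {} (\<lambda>x. ()) (homologous_rel_set 0 X {} c)
      = homologous_rel_set 0 ?pt {} (chain_map 0 (\<lambda>x. ()) c)"
    using hom_induced_chain_map[of X ?pt "\<lambda>x. ()" "{}" "{}" 0 c] assms True by simp
  moreover have "homologous_rel_set 0 ?pt {} (chain_map 0 (\<lambda>x. ()) c) = \<one>\<^bsub>homology_group 0 ?pt\<^esub>
      \<longleftrightarrow> singular_relboundary 0 ?pt {} (chain_map 0 (\<lambda>x. ()) c)"
    using one_relative_homology_group[of 0 ?pt "{}"]
    by (simp add: homologous_rel_set_eq_relboundary)
  moreover have "singular_relboundary 0 ?pt {} (chain_map 0 (\<lambda>x. ()) c) \<longleftrightarrow> augmentation c = 0"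
    using singular_boundary_singleton[of ?pt "()" 0] singular_chain_chain_map[OF c, of ?pt "\<lambda>x. ()"]
    by (auto simp: cm)
  moreover have "homologous_rel_set 0 X {} c \<in> carrier (homology_group 0 X)"
    using assms True carrier_relative_homology_group_0[of X "{}"] by auto
  ultimately show ?thesis
    using assms True
    by (simp add: carrier_reduced_homology_group kernel_def reduced_cycle_def singular_cycle)
qed

lemma reduced_cycle_bounds_if_trivial:
  assumes "trivial_group (reduced_homology_group (int p) X)" "reduced_cycle p X c"
  shows "bounds p X c"
proof -
  have "homologous_rel_set p X {} c \<in> carrier (reduced_homology_group (int p) X)"
    using assms(2) reduced_cycle_iff_class[of p X c] by (simp add: reduced_cycle_def singular_cycle)
  then have "homologous_rel_set p X {} c = \<one>\<^bsub>reduced_homology_group (int p) X\<^esub>"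
    using assms(1) by (simp add: trivial_group_def)
  then show ?thesis
    by (simp add: one_reduced_homology_group homologous_rel_set_eq_relboundary bounds_iff_relboundary)
qed

lemma mult_homologous_rel_set:
  "homologous_rel_set p X S a \<otimes>\<^bsub>relative_homology_group (int p) X S\<^esub> homologous_rel_set p X S b
     = homologous_rel_set p X S (a + b)"
  unfolding mult_relative_homology_group
proof (intro equalityI subsetI)
  fix c assume "c \<in> homologous_rel_set p X S (a + b)"
  then have "homologous_rel p X S (a + b) c" by simp
  then have "homologous_rel p X S b (c - a)"
    using homologous_rel_diff[of p X S "a + b" c a a] by simp
  then show "c \<in> (\<Union>r\<in>homologous_rel_set p X S a. \<Union>s\<in>homologous_rel_set p X S b. {r + s})"
    by (intro UN_I[of a] UN_I[of "c - a"]) auto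
qed (auto intro: homologous_rel_add)

text \<open>The element \<open>1\<close> of the integers is the class of a cycle \<open>s\<close>, and \<open>j\<close> corresponds to the class of
  \<open>j s\<close>; surjectivity and injectivity of the isomorphism give the last two claims.\<close>
lemma reduced_homology_generator:
  assumes "reduced_homology_group (int p) X \<cong> integer_group"
  obtains s where "reduced_cycle p X s"
    "\<And>c. reduced_cycle p X c \<Longrightarrow> \<exists>j. bounds p X (c - frag_cmul j s)"
    "\<And>j. bounds p X (frag_cmul j s) \<Longrightarrow> j = 0"
proof -
  let ?G = "reduced_homology_group (int p) X"
  have "integer_group \<cong> ?G"
    using assms group.iso_sym group_reduced_homology_group by blast
  then obtain f where f: "f \<in> iso integer_group ?G"
    by (auto simp: is_iso_def)
  have fm: "f (i + j) = f i \<otimes>\<^bsub>homology_group (int p) X\<^esub> f j" for i j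
    using f by (auto simp: iso_def hom_def integer_group_def reduced_homology_group_def)
  have fb: "bij_betw f UNIV (carrier ?G)"
    using f by (auto simp: iso_def)
  have "f 1 \<in> carrier (homology_group (int p) X)"
    using fb carrier_reduced_homology_group_subset by (blast dest: bij_betwE)
  then obtain s where s: "singular_relcycle p X {} s" "f 1 = homologous_rel_set p X {} s"
    by (auto simp: carrier_relative_homology_group)
  have fj: "f j = homologous_rel_set p X {} (frag_cmul j s)" for j
  proof -
    have inj: "f j = f (j - 1) \<otimes>\<^bsub>homology_group (int p) X\<^esub> f 1" for j
      using fm[of "j - 1" 1] by simp
    have f0: "f 0 = homologous_rel_set p X {} 0"
    proof -
      have "f \<in> hom integer_group ?G" using f by (simp add: iso_def)
      then have "f \<one>\<^bsub>integer_group\<^esub> = \<one>\<^bsub>?G\<^esub>"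
        using hom_one[of f integer_group ?G] by simp
      moreover have "homologous_rel_set p X {} 0 = singular_relboundary_set p X {}"
        by (simp add: homologous_rel_set_eq_relboundary)
      ultimately show ?thesis
        by (simp add: one_reduced_homology_group)
    qed
    have pos: "f (int n) = homologous_rel_set p X {} (frag_cmul (int n) s)" for n
      by (induction n) (simp_all add: f0 fm s mult_homologous_rel_set frag_cmul_distrib add.commute)
    have neg1: "f (-1) = homologous_rel_set p X {} (- s)"
    proof -
      have "f (-1) \<in> carrier (homology_group (int p) X)"
        using fb carrier_reduced_homology_group_subset by (blast dest: bij_betwE)
      then obtain t where t: "f (-1) = homologous_rel_set p X {} t"
        by (auto simp: carrier_relative_homology_group)
      have "homologous_rel_set p X {} (s + t) = homologous_rel_set p X {} 0"
        using fm[of 1 "-1"] by (simp add: f0 s t mult_homologous_rel_set)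
      then have "homologous_rel p X {} (s + t) 0"
        by (simp only: homologous_rel_set_eq)
      then have "homologous_rel p X {} t (- s)"
        by (simp add: homologous_rel_def add.commute)
      then show ?thesis
        using t by (metis homologous_rel_set_eq)
    qed
    have neg: "f (- int n) = homologous_rel_set p X {} (frag_cmul (- int n) s)" for n
    proof (induction n)
      case (Suc n)
      have "f (- int (Suc n)) = f (- int n) \<otimes>\<^bsub>homology_group (int p) X\<^esub> f (-1)"
        using fm[of "- int n" "-1"] by (simp add: add.commute)
      also have "\<dots> = homologous_rel_set p X {} (frag_cmul (- int n) s + - s)"
        by (simp only: Suc neg1 mult_homologous_rel_set)
      also have "frag_cmul (- int n) s + - s = frag_cmul (- int (Suc n)) s"
        using frag_cmul_distrib[of "- int n" "-1" s] by (simp add: add.commute)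
      finally show ?case .
    qed (simp add: f0)
    show ?thesis
      using pos[of "nat j"] neg[of "nat (- j)"] by (cases "0 \<le> j") auto
  qed
  show ?thesis
  proof
    show "reduced_cycle p X s"
      using reduced_cycle_iff_class[OF s(1)] s(2) fb by (metis UNIV_I bij_betwE)
    fix c assume c: "reduced_cycle p X c"
    then have "homologous_rel_set p X {} c \<in> carrier ?G"
      using reduced_cycle_iff_class[of p X c] by (simp add: reduced_cycle_def singular_cycle)
    then obtain j where "homologous_rel_set p X {} c = f j"
      using fb by (auto simp: bij_betw_def)
    then have "homologous_rel p X {} c (frag_cmul j s)"
      by (simp only: fj homologous_rel_set_eq)
    then have "bounds p X (c - frag_cmul j s)"
      by (simp add: homologous_rel_def bounds_iff_relboundary)
    then show "\<exists>j. bounds p X (c - frag_cmul j s)" ..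
  next
    fix j assume "bounds p X (frag_cmul j s)"
    then have "homologous_rel p X {} (frag_cmul j s) (frag_cmul 0 s)"
      by (simp add: homologous_rel_def bounds_iff_relboundary)
    then have "f j = f 0" by (simp only: fj homologous_rel_set_eq)
    then show "j = 0"
      using fb by (auto simp: bij_betw_def inj_on_def)
  qed
qed

section \<open>Attaching a cell: excision and radial collapse\<close>

definition radius :: "nat \<Rightarrow> (nat \<Rightarrow> real) \<Rightarrow> real" where
  "radius k x = sqrt (\<Sum>i<k. (x i)\<^sup>2)"

text \<open>Scaling by \<open>1 + t\<close>, cut off at the unit sphere. As \<open>t\<close> runs from 0 to 1, the identity of the disc is
  deformed, relative to the sphere, into a map that collapses the points of radius more than \<open>1/2\<close> to
  the sphere.\<close>
definition push :: "nat \<Rightarrow> real \<Rightarrow> (nat \<Rightarrow> real) \<Rightarrow> nat \<Rightarrow> real" where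
  "push k t x = (\<lambda>i. (1 + t) * x i / max 1 ((1 + t) * radius k x))"

lemma unit_disc_eq: "unit_disc k = {x. (\<forall>i\<ge>k. x i = 0) \<and> radius k x \<le> 1}"
  by (auto simp: unit_disc_def radius_def topspace_Euclidean_space)

lemma unit_sphere_eq: "unit_sphere k = {x. (\<forall>i\<ge>k. x i = 0) \<and> radius k x = 1}"
  by (auto simp: unit_sphere_def radius_def topspace_Euclidean_space)

lemma unit_sphere_subset: "unit_sphere k \<subseteq> unit_disc k"
  by (auto simp: unit_disc_eq unit_sphere_eq)

lemma radius_nonneg: "0 \<le> radius k x"
  by (simp add: radius_def sum_nonneg)

lemma radius_scale: "radius k (\<lambda>i. c * x i) = \<bar>c\<bar> * radius k x"
  by (simp add: radius_def power_mult_distrib real_sqrt_mult flip: sum_distrib_left)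

lemma zero_in_unit_disc: "(\<lambda>_. 0) \<in> unit_disc k"
  and zero_notin_unit_sphere: "(\<lambda>_. 0) \<notin> unit_sphere k"
  by (auto simp: unit_disc_eq unit_sphere_eq radius_def)

lemma subtopology_unit_disc:
  "S \<subseteq> unit_disc k \<Longrightarrow> subtopology (Euclidean_space k) S = top_of_set S"
  by (auto simp: Euclidean_space_def subtopology_subtopology unit_disc_eq euclidean_product_topology
      intro!: arg_cong[where f = "subtopology euclidean"])

lemma continuous_on_radius: "continuous_on S (radius k)"
  unfolding radius_def
  by (intro continuous_intros continuous_on_subset[OF continuous_on_product_coordinates]) auto

lemma compact_unit_disc: "compact (unit_disc k)"
proof -
  have c: "closed {x. (\<forall>i\<ge>k. x i = (0::real)) \<and> radius k x \<le> 1}"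
    by (intro closed_Collect_conj closed_Collect_all closed_Collect_imp closed_Collect_eq
        closed_Collect_le continuous_on_radius) auto
  have "\<bar>x i\<bar> \<le> 1" if "x \<in> unit_disc k" for x i
  proof (cases "i < k")
    case True
    then have "(x i)\<^sup>2 \<le> (\<Sum>i<k. (x i)\<^sup>2)"
      by (intro member_le_sum) auto
    also have "\<dots> \<le> 1"
      using that by (simp add: unit_disc_def)
    finally show ?thesis
      by (simp add: abs_square_le_1)
  qed (use that in \<open>simp add: unit_disc_eq\<close>)
  then have "unit_disc k \<subseteq> (\<Pi>\<^sub>E i\<in>UNIV. {-1..1})"
    by (force simp: abs_le_iff)
  moreover have "compactin (powertop_real UNIV) (\<Pi>\<^sub>E i\<in>UNIV. {-1..1})"
    by (simp add: compactin_PiE)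
  ultimately have "compactin (powertop_real UNIV) (unit_disc k)"
    using closed_compactin c by (metis unit_disc_eq closed_closedin euclidean_product_topology)
  then show ?thesis
    by (simp add: euclidean_product_topology)
qed

lemma push_in_unit_disc:
  assumes "x \<in> unit_disc k" "0 \<le> t"
  shows "push k t x \<in> unit_disc k"
proof -
  have "radius k (push k t x) = \<bar>(1 + t) / max 1 ((1 + t) * radius k x)\<bar> * radius k x"
    unfolding radius_scale[symmetric] by (simp add: push_def)
  also have "\<dots> \<le> 1"
    using assms(2) radius_nonneg[of k x] by (auto simp: divide_le_eq max_def abs_mult)
  finally show ?thesis
    using assms(1) by (simp add: unit_disc_eq push_def)
qed

lemma push_0: "x \<in> unit_disc k \<Longrightarrow> push k 0 x = x"
  by (simp add: push_def unit_disc_eq max.absorb1)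

lemma push_sphere: "\<lbrakk>x \<in> unit_sphere k; 0 \<le> t\<rbrakk> \<Longrightarrow> push k t x = x"
  by (simp add: push_def unit_sphere_eq max_def)

lemma push_1_in_unit_sphere:
  assumes "x \<in> unit_disc k" "1/2 < radius k x"
  shows "push k 1 x \<in> unit_sphere k"
proof -
  have "radius k (push k 1 x) = \<bar>2 / max 1 (2 * radius k x)\<bar> * radius k x"
    unfolding radius_scale[symmetric] by (simp add: push_def)
  also have "\<dots> = 1"
    using assms(2) by (auto simp: max_def)
  finally show ?thesis
    using assms(1) by (simp add: unit_sphere_eq unit_disc_eq push_def)
qed

lemma continuous_on_push:
  "continuous_on ({0..1} \<times> unit_disc k) (\<lambda>z. push k (fst z) (snd z))"
proof -
  have 1: "continuous_on ({0..1} \<times> unit_disc k) (\<lambda>z. snd z i)" for i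
    by (intro continuous_on_compose2[OF continuous_on_product_coordinates[of i] continuous_on_snd])
      auto
  have 2: "continuous_on ({0..1::real} \<times> unit_disc k) (\<lambda>z. radius k (snd z))"
    by (rule continuous_on_compose2[OF continuous_on_radius[of UNIV] continuous_on_snd]) auto
  show ?thesis
    unfolding push_def
    by (intro continuous_on_coordinatewise_then_product continuous_intros 1 2)
      (auto simp: max_def)
qed

lemma contractible_unit_disc: "contractible_space (top_of_set (unit_disc k))"
proof -
  have "homotopic_with (\<lambda>_. True) (top_of_set (unit_disc k)) (top_of_set (unit_disc k)) id (\<lambda>_ _. 0)"
    unfolding homotopic_with_def
  proof (intro exI conjI allI ballI)
    let ?H = "\<lambda>z i. (1 - fst z) * (snd z :: nat \<Rightarrow> real) i :: real"
    have 1: "continuous_on ({0..1} \<times> unit_disc k) (\<lambda>z. snd z i)" for i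
      by (intro continuous_on_compose2[OF continuous_on_product_coordinates[of i] continuous_on_snd])
        auto
    have "continuous_on ({0..1} \<times> unit_disc k) ?H"
      by (intro continuous_on_coordinatewise_then_product continuous_intros 1)
    moreover have "?H z \<in> unit_disc k" if "z \<in> {0..1} \<times> unit_disc k" for z
    proof -
      have "\<bar>1 - fst z\<bar> * radius k (snd z) \<le> 1 * 1"
        using that radius_nonneg by (intro mult_mono) (auto simp: unit_disc_eq)
      then show ?thesis
        using that by (auto simp: unit_disc_eq radius_scale)
    qed
    ultimately show "continuous_map (prod_topology (top_of_set {0..1}) (top_of_set (unit_disc k)))
        (top_of_set (unit_disc k)) ?H"
      by (simp add: Pi_iff)
  qed auto
  then show ?thesis
    unfolding contractible_space_def by blast
qed

lemma homeomorphic_boundary_sphere: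
  assumes h: "homeomorphic_map (subtopology (Euclidean_space (Suc m)) (unit_disc (Suc m))) Y h"
  shows "nsphere m homeomorphic_space subtopology Y (h ` unit_sphere (Suc m))"
proof -
  have "nsphere m = subtopology (Euclidean_space (Suc m)) (unit_sphere (Suc m))"
    unfolding nsphere_def lessThan_Suc_atMost unit_sphere_def
    using subtopology_restrict[of "Euclidean_space (Suc m)" "{x. (\<Sum>i\<le>m. (x i)\<^sup>2) = 1}"]
    by (simp add: Int_def)
  also have "\<dots> = subtopology (subtopology (Euclidean_space (Suc m)) (unit_disc (Suc m)))
      (unit_sphere (Suc m))"
    by (simp add: subtopology_subtopology unit_sphere_subset inf.absorb2)
  also have "\<dots> homeomorphic_space subtopology Y (h ` unit_sphere (Suc m))"
  proof (rule homeomorphic_map_imp_homeomorphic_space[OF homeomorphic_map_subtopologies[OF h]])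
    let ?D = "subtopology (Euclidean_space (Suc m)) (unit_disc (Suc m))"
    have "topspace ?D \<inter> unit_sphere (Suc m) = unit_sphere (Suc m)"
      by (auto simp: unit_disc_eq unit_sphere_eq topspace_Euclidean_space)
    moreover have "h ` unit_sphere (Suc m) \<subseteq> topspace Y"
      unfolding homeomorphic_imp_surjective_map[OF h, symmetric]
      by (auto simp: unit_disc_eq unit_sphere_eq topspace_Euclidean_space)
    ultimately show "h ` (topspace ?D \<inter> unit_sphere (Suc m)) = topspace Y \<inter> h ` unit_sphere (Suc m)"
      by auto
  qed
  finally show ?thesis .
qed

lemma relcycle_mono:
  "\<lbrakk>singular_relcycle p X S c; S \<subseteq> S'\<rbrakk> \<Longrightarrow> singular_relcycle p X S' c"
  by (auto simp: singular_relcycle intro: singular_chain_mono)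

lemma relboundary_mono:
  "\<lbrakk>singular_relboundary p (subtopology X T) S c; S \<subseteq> S'\<rbrakk> \<Longrightarrow> singular_relboundary p X S' c"
  unfolding singular_relboundary_alt
  by (metis (no_types, lifting) inf.coboundedI2 singular_chain_mono singular_chain_subtopology
      subtopology_subtopology)

text \<open>The injectivity half of excision, for chains.\<close>
lemma excision_reflects_boundary:
  assumes "X closure_of U \<subseteq> X interior_of T" "T \<subseteq> S"
    and c: "singular_relcycle p (subtopology X (S - U)) (T - U) c"
    and b: "singular_relboundary p (subtopology X S) T c"
  shows "singular_relboundary p (subtopology X (S - U)) (T - U) c"
proof -
  let ?Y = "subtopology X (S - U)" and ?Z = "subtopology X S"
  let ?i = "hom_induced (int p) ?Y (T - U) ?Z T id"
  let ?cls = "homologous_rel_set p ?Y (T - U)"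
  have inj: "inj_on ?i (carrier (relative_homology_group (int p) ?Y (T - U)))"
    using homology_excision_axiom[OF assms(1,2), of "int p"] by (auto simp: iso_def bij_betw_def)
  have cont: "continuous_map ?Y ?Z id"
    by (auto intro: continuous_map_into_subtopology continuous_map_from_subtopology)
  have i: "?i (?cls a) = homologous_rel_set p ?Z T a" if "singular_relcycle p ?Y (T - U) a" for a
    using hom_induced_chain_map[OF cont _ that, of T] that chain_map_ident[of p ?Y a]
    by (simp add: Pi_iff singular_relcycle)
  have "homologous_rel p ?Z T c 0"
    using b by (simp add: homologous_rel_def)
  then have "?i (?cls c) = ?i (?cls 0)"
    using i[OF c] i[of 0] by (simp add: homologous_rel_set_eq)
  moreover have "?cls a \<in> carrier (relative_homology_group (int p) ?Y (T - U))"
    if "singular_relcycle p ?Y (T - U) a" for a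
    using that by (simp add: carrier_relative_homology_group)
  ultimately have "?cls c = ?cls 0"
    using inj_onD[OF inj] c singular_relcycle_0 by blast
  then have "homologous_rel p ?Y (T - U) c 0"
    by (simp only: homologous_rel_set_eq)
  then show ?thesis
    by (simp add: homologous_rel_def)
qed

text \<open>A space glued from a closed cell \<open>T\<close> and a closed set \<open>L\<close> along the boundary sphere of \<open>T\<close>. The aim is
  that the inclusion of \<open>(T, T \<inter> L)\<close> in \<open>(X, L)\<close> is an isomorphism in relative homology
  (\<open>relcycle_supported_on_cell\<close> and \<open>relboundary_supported_on_cell\<close>). Excising \<open>L\<close> itself is possible
  after \<open>L\<close> has been thickened to an open collar, which the flow collapses back into \<open>L\<close>.\<close>
locale attached_cell =
  fixes X :: "'a topology" and T L :: "'a set" and k :: nat and h :: "(nat \<Rightarrow> real) \<Rightarrow> 'a"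
  assumes closed_T: "closedin X T" and closed_L: "closedin X L"
    and cover: "T \<union> L = topspace X"
    and homeo: "homeomorphic_map (subtopology (Euclidean_space k) (unit_disc k)) (subtopology X T) h"
    and boundary: "h ` unit_sphere k = T \<inter> L"
begin

definition "flow t y = (if y \<in> T then h (push k t (inv_into (unit_disc k) h y)) else y)"

definition "collar = L \<union> h ` {x \<in> unit_disc k. 1/2 < radius k x}"

lemma T_subset: "T \<subseteq> topspace X" and L_subset: "L \<subseteq> topspace X"
  using cover by auto

lemma homeo': "homeomorphic_map (top_of_set (unit_disc k)) (subtopology X T) h"
  using homeo by (simp add: subtopology_unit_disc)

lemma image_h: "h ` unit_disc k = T" and inj_h: "inj_on h (unit_disc k)"
  and cont_h: "continuous_map (top_of_set (unit_disc k)) (subtopology X T) h"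
  using homeo' T_subset
  by (auto simp: homeomorphic_eq_everything_map inf.absorb2)

lemma inv_h: "x \<in> unit_disc k \<Longrightarrow> inv_into (unit_disc k) h (h x) = x"
  by (simp add: inj_h)

lemma cont_inv: "continuous_map (subtopology X T) (top_of_set (unit_disc k)) (inv_into (unit_disc k) h)"
proof -
  obtain g where g: "homeomorphic_maps (top_of_set (unit_disc k)) (subtopology X T) h g"
    using homeo' homeomorphic_map_maps by blast
  have "g y = inv_into (unit_disc k) h y" if "y \<in> topspace (subtopology X T)" for y
    using that g image_h inv_h by (force simp: homeomorphic_maps_def)
  then show ?thesis
    using g continuous_map_eq[of "subtopology X T" _ g] unfolding homeomorphic_maps_def by blast
qed

lemma h_in_T: "x \<in> unit_disc k \<Longrightarrow> h x \<in> T"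
  using image_h by blast

lemma T_cases:
  assumes "y \<in> T" obtains x where "x \<in> unit_disc k" "y = h x"
  using assms image_h by blast

lemma flow_h: "x \<in> unit_disc k \<Longrightarrow> flow t (h x) = h (push k t x)"
  by (simp add: flow_def h_in_T inv_h)

lemma flow_in_T:
  assumes "y \<in> T" "0 \<le> t" shows "flow t y \<in> T"
  using assms by (elim T_cases) (simp add: flow_h h_in_T push_in_unit_disc)

lemma flow_on_L:
  assumes "y \<in> L" "0 \<le> t" shows "flow t y = y"
proof (cases "y \<in> T")
  case True
  then obtain x where "x \<in> unit_sphere k" "y = h x"
    using assms boundary by blast
  then show ?thesis
    using assms flow_h[of x t] unit_sphere_subset[of k] push_sphere[of x k t] by auto
qed (simp add: flow_def)

lemma flow_0: "flow 0 y = y"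
proof (cases "y \<in> T")
  case True
  then show ?thesis by (elim T_cases) (simp add: flow_h push_0)
qed (simp add: flow_def)

lemma flow_collar:
  assumes "y \<in> collar" shows "flow 1 y \<in> L"
proof (cases "y \<in> L")
  case False
  then obtain x where x: "x \<in> unit_disc k" "1/2 < radius k x" "y = h x"
    using assms by (auto simp: collar_def)
  then have "flow 1 y \<in> h ` unit_sphere k"
    by (simp add: flow_h push_1_in_unit_sphere)
  then show ?thesis by (simp add: boundary)
qed (simp add: flow_on_L)

lemma continuous_flow: "continuous_map (prod_topology (top_of_set {0..1}) X) X (\<lambda>z. flow (fst z) (snd z))"
proof (rule pasting_lemma_closed[where I = UNIV and
      T = "\<lambda>b. if b then {0..1::real} \<times> T else {0..1} \<times> L" and
      f = "\<lambda>b z. if b then flow (fst z) (snd z) else snd z"])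
  let ?Z = "prod_topology (top_of_set {0..1::real}) X"
  show "closedin ?Z (if b then {0..1} \<times> T else {0..1} \<times> L)" for b
    using closed_T closed_L by (auto simp: closedin_prod_Times_iff)
  show "continuous_map (subtopology ?Z (if b then {0..1} \<times> T else {0..1} \<times> L)) X
      (\<lambda>z. if b then flow (fst z) (snd z) else snd z)" for b
  proof (cases b)
    case False
    then show ?thesis
      by (simp add: continuous_map_from_subtopology continuous_map_snd)
  next
    case True
    have "continuous_map (prod_topology (top_of_set {0..1::real}) (subtopology X T))
        (prod_topology (top_of_set {0..1}) (top_of_set (unit_disc k)))
        (\<lambda>z. (fst z, inv_into (unit_disc k) h (snd z)))"
      by (intro continuous_map_pairedI continuous_map_fst
          continuous_map_compose[OF continuous_map_snd cont_inv, unfolded o_def])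
    moreover have "continuous_map (prod_topology (top_of_set {0..1}) (top_of_set (unit_disc k)))
        (top_of_set (unit_disc k)) (\<lambda>z. push k (fst z) (snd z))"
      using continuous_on_push push_in_unit_disc by (auto simp: Pi_iff)
    moreover have "continuous_map (top_of_set (unit_disc k)) X h"
      using cont_h continuous_map_into_fulltopology by blast
    ultimately have "continuous_map (prod_topology (top_of_set {0..1::real}) (subtopology X T)) X
        (h \<circ> (\<lambda>z. push k (fst z) (snd z)) \<circ> (\<lambda>z. (fst z, inv_into (unit_disc k) h (snd z))))"
      by (intro continuous_map_compose)
    moreover have "subtopology ?Z ({0..1} \<times> T) = prod_topology (top_of_set {0..1}) (subtopology X T)"
      by (simp add: prod_topology_subtopology subtopology_subtopology Times_Int_Times)
    ultimately show ?thesis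
      using True by (auto simp: flow_def o_def intro: continuous_map_eq)
  qed
  show "(if i then flow (fst z) (snd z) else snd z) = (if j then flow (fst z) (snd z) else snd z)"
    if "z \<in> topspace ?Z \<inter> (if i then {0..1} \<times> T else {0..1} \<times> L)
      \<inter> (if j then {0..1} \<times> T else {0..1} \<times> L)" for i j z
    using that flow_on_L by (auto split: if_splits)
  show "\<exists>j. j \<in> UNIV \<and> z \<in> (if j then {0..1} \<times> T else {0..1} \<times> L) \<and>
      flow (fst z) (snd z) = (if j then flow (fst z) (snd z) else snd z)"
    if "z \<in> topspace ?Z" for z
    using that flow_on_L cover
    by (cases "snd z \<in> T") (auto simp: mem_Times_iff intro: exI[of _ True] exI[of _ False])
qed auto

lemma continuous_flow_1: "continuous_map X X (flow 1)"
proof -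
  have "continuous_map X (prod_topology (top_of_set {0..1}) X) (\<lambda>y. (1::real, y))"
    by (intro continuous_map_pairedI) (auto simp: zero_le_one le_refl)
  then show ?thesis
    using continuous_map_compose[OF _ continuous_flow] by (fastforce simp: o_def)
qed

lemma homologous_flow:
  assumes "singular_relcycle p X L c"
  shows "homologous_rel p X L c (chain_map p (flow 1) c)"
proof -
  have "homotopic_with (\<lambda>f. f \<in> L \<rightarrow> L) X X (flow 0) (flow 1)"
    unfolding homotopic_with_def
    by (intro exI[of _ "\<lambda>z. flow (fst z) (snd z)"]) (use continuous_flow flow_on_L in auto)
  then have "homologous_rel p X L (chain_map p (flow 0) c) (chain_map p (flow 1) c)"
    using homotopic_imp_homologous_rel_chain_maps assms by blast
  moreover have "chain_map p (flow 0) c = c"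
    using assms chain_map_id_gen[of p X c "flow 0"] flow_0 by (simp add: singular_relcycle)
  ultimately show ?thesis by simp
qed

lemma openin_collar: "openin X collar"
proof -
  have "closed {x. radius k x \<le> 1/2}"
    by (intro closed_Collect_le continuous_on_radius) auto
  then have "closedin (top_of_set (unit_disc k)) {x \<in> unit_disc k. radius k x \<le> 1/2}"
    by (simp add: closedin_closed_Int Collect_conj_eq)
  then have "closedin X (h ` {x \<in> unit_disc k. radius k x \<le> 1/2})"
    using homeomorphic_map_closedness_eq[OF homeo'] closedin_trans_full[OF _ closed_T] by blast
  moreover have "topspace X - h ` {x \<in> unit_disc k. radius k x \<le> 1/2} = collar"
  proof -
    have "radius k x = 1" if "x \<in> unit_disc k" "h x \<in> L" for x
    proof -
      have "h x \<in> h ` unit_sphere k" using that boundary image_h by auto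
      then show ?thesis
        using that(1) inj_h unit_sphere_subset by (force simp: unit_sphere_eq dest: inj_onD)
    qed
    then show ?thesis
      unfolding cover[symmetric] collar_def image_h[symmetric]
      using inj_h by (force dest: inj_onD)
  qed
  ultimately show ?thesis
    using openin_diff[OF openin_topspace[of X]] by metis
qed

lemma collar_subset: "L \<subseteq> collar" "collar \<subseteq> topspace X" "collar - L \<subseteq> T"
  using L_subset T_subset image_h by (auto simp: collar_def)

lemma excision_condition: "X closure_of L \<subseteq> X interior_of collar"
  using closed_L openin_collar collar_subset by (simp add: closure_of_closedin interior_of_openin)

text \<open>Relative to the collar, \<open>c\<close> can be moved into the open cell by excision. Relative to \<open>L\<close> it does
  not change under the flow, which at time 1 takes collar chains to chains in \<open>L\<close>.\<close>
lemma concentrate_in_cell: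
  assumes "singular_relcycle p X L c"
  obtains d where "singular_relcycle p (subtopology X (T - L)) (collar - L) d"
    "homologous_rel p X collar c d" "homologous_rel p X L c (chain_map p (flow 1) d)"
proof -
  have "singular_relcycle p (subtopology X (topspace X)) collar c"
    using assms collar_subset(1) by (simp add: relcycle_mono)
  then obtain d where d: "singular_relcycle p (subtopology X (topspace X - L)) (collar - L) d"
    "homologous_rel p (subtopology X (topspace X)) collar c d"
    using excised_relcycle_exists[OF excision_condition collar_subset(2)] by blast
  have "topspace X - L = T - L" using cover by auto
  moreover have "homologous_rel p X L (chain_map p (flow 1) c) (chain_map p (flow 1) d)"
    using d(2) singular_relboundary_chain_map[OF _ continuous_flow_1, of p collar "c - d" L] flow_collar
    by (simp add: homologous_rel_def chain_map_diff Pi_iff)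
  then have "homologous_rel p X L c (chain_map p (flow 1) d)"
    using homologous_flow[OF assms] by (rule homologous_rel_trans)
  ultimately show thesis
    using that[of d] d by simp
qed

lemma continuous_flow_cell: "continuous_map (subtopology X (T - L)) (subtopology X T) (flow 1)"
  using continuous_flow_1 flow_in_T
  by (auto simp: continuous_map_in_subtopology continuous_map_from_subtopology)

lemma flow_collar_cell: "flow 1 \<in> collar - L \<rightarrow> T \<inter> L"
  using flow_collar flow_in_T collar_subset by (intro Pi_I IntI) auto

lemma relcycle_supported_on_cell:
  assumes "singular_relcycle p X L c"
  obtains d where "singular_relcycle p (subtopology X T) (T \<inter> L) d" "homologous_rel p X L c d"
  using concentrate_in_cell[OF assms]
    singular_relcycle_chain_map[OF _ continuous_flow_cell flow_collar_cell] by metis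

lemma attached_cell_restrict: "attached_cell (subtopology X T) T (T \<inter> L) k h"
proof
  show "closedin (subtopology X T) (T \<inter> L)"
    using closed_L by (simp add: closedin_subtopology_Int_closed)
qed (use closed_T T_subset homeo boundary in
    \<open>auto simp: closedin_subtopology_refl subtopology_subtopology\<close>)

text \<open>Both \<open>(T, T \<inter> L)\<close> and \<open>(X, L)\<close> are compared with the same pair inside the open cell. The chain \<open>d\<close>
  that replaces \<open>c\<close> there bounds in \<open>X\<close> relative to the collar, hence by excision in the open cell, and
  the flow carries this back to \<open>(T, T \<inter> L)\<close>.\<close>
lemma relboundary_supported_on_cell:
  assumes c: "singular_relcycle p (subtopology X T) (T \<inter> L) c" and b: "singular_relboundary p X L c"
  shows "singular_relboundary p (subtopology X T) (T \<inter> L) c"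
proof -
  interpret cell: attached_cell "subtopology X T" T "T \<inter> L" k h
    by (rule attached_cell_restrict)
  have flow: "cell.flow = flow"
    by (simp add: cell.flow_def flow_def fun_eq_iff)
  have collar: "cell.collar \<subseteq> collar" "cell.collar - T \<inter> L = collar - L"
    using image_h by (auto simp: cell.collar_def collar_def)
  have minus: "T - T \<inter> L = T - L" "T \<inter> (T - L) = T - L" by auto
  from cell.concentrate_in_cell[OF c] obtain d
    where d: "singular_relcycle p (subtopology X (T - L)) (collar - L) d"
      "homologous_rel p (subtopology X T) cell.collar c d"
      "homologous_rel p (subtopology X T) (T \<inter> L) c (chain_map p (flow 1) d)"
    by (metis flow collar(2) minus subtopology_subtopology)
  have "singular_relboundary p X collar (c - d)"
    using d(2) collar(1) relboundary_mono by (auto simp: homologous_rel_def)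
  moreover have "singular_relboundary p X collar c"
    using relboundary_mono[of p X UNIV L c collar] b collar_subset(1) by simp
  ultimately have "singular_relboundary p X collar d"
    using singular_relboundary_diff[of p X collar c "c - d"] by simp
  moreover have top: "topspace X - L = T - L" using cover by auto
  ultimately have "singular_relboundary p (subtopology X (T - L)) (collar - L) d"
    using excision_reflects_boundary[OF excision_condition collar_subset(2), of p d] d(1) by simp
  then have "singular_relboundary p (subtopology X T) (T \<inter> L) (chain_map p (flow 1) d)"
    using singular_relboundary_chain_map[OF _ continuous_flow_cell flow_collar_cell] by blast
  then show ?thesis
    using d(3) singular_relboundary_add by (fastforce simp: homologous_rel_def)
qed

end

section \<open>Regular cell complexes\<close>

locale cell_complex =
  fixes K :: "'p cell_cplx"
  assumes cellular: "cellular_complex K"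
begin

abbreviation X where "X \<equiv> space_of K"
abbreviation dm where "dm \<equiv> cdim K"
abbreviation ss where "ss \<equiv> strict_subcells K"
abbreviation cl where "cl T \<equiv> insert T (ss T)"
abbreviation body where "body L \<equiv> subtopology X (\<Union>L)"

lemma regular: "regular_cells K" and oriented: "relative_orientation K"
  using cellular by (auto simp: cellular_complex_def)

lemma hausdorff: "Hausdorff_space X"
  using regular by (simp add: regular_cells_def)

lemma is_cell: "T \<in> cells K \<Longrightarrow> is_cell X (dm T) T (bdry K T)"
  using regular by (simp add: regular_cells_def)

lemma finite_ss: "T \<in> cells K \<Longrightarrow> finite (ss T)"
  using regular by (simp add: regular_cells_def)

lemma open_cells_disjoint:
  "\<lbrakk>T \<in> cells K; S \<in> cells K; x \<in> T - bdry K T; x \<in> S - bdry K S\<rbrakk> \<Longrightarrow> S = T"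
  using regular unfolding regular_cells_def by blast

lemma bdry_union: "T \<in> cells K \<Longrightarrow> \<exists>F \<subseteq> {S \<in> cells K. dm S < dm T}. bdry K T = \<Union>F"
  using regular by (simp add: regular_cells_def)

lemma cell_chart:
  assumes "T \<in> cells K"
  obtains h where "homeomorphic_map (subtopology (Euclidean_space (dm T)) (unit_disc (dm T)))
      (subtopology X T) h" "h ` unit_sphere (dm T) = bdry K T" "h ` unit_disc (dm T) = T"
    "inj_on h (unit_disc (dm T))" "T \<subseteq> topspace X"
proof -
  obtain h where T: "T \<subseteq> topspace X" and
    h: "homeomorphic_map (subtopology (Euclidean_space (dm T)) (unit_disc (dm T))) (subtopology X T) h"
    "h ` unit_sphere (dm T) = bdry K T"
    using is_cell[OF assms] unfolding is_cell_def by blast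
  have "homeomorphic_map (top_of_set (unit_disc (dm T))) (subtopology X T) h"
    using h(1) by (simp add: subtopology_unit_disc)
  then have "h ` unit_disc (dm T) = T" "inj_on h (unit_disc (dm T))"
    using T by (auto simp: homeomorphic_eq_everything_map inf.absorb2)
  with h T show thesis using that by blast
qed

lemma bdry_subset: "T \<in> cells K \<Longrightarrow> bdry K T \<subseteq> T"
  by (metis cell_chart image_mono unit_sphere_subset)

lemma open_cell_nonempty:
  assumes "T \<in> cells K" shows "T - bdry K T \<noteq> {}"
proof -
  obtain h where h: "h ` unit_sphere (dm T) = bdry K T" "h ` unit_disc (dm T) = T"
    "inj_on h (unit_disc (dm T))"
    using cell_chart[OF assms] by metis
  have "h (\<lambda>_. 0) \<notin> bdry K T"
  proof
    assume "h (\<lambda>_. 0) \<in> bdry K T"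
    then obtain x where "x \<in> unit_sphere (dm T)" "h x = h (\<lambda>_. 0)"
      using h(1) by (metis imageE)
    then show False
      using inj_onD[OF h(3)] unit_sphere_subset[of "dm T"] zero_in_unit_disc zero_notin_unit_sphere
      by blast
  qed
  then show ?thesis
    using h(2) zero_in_unit_disc by blast
qed

text \<open>A point that is not in the open cell of \<open>T\<close> lies in a boundary cell of smaller dimension, so the
  descent on the dimension stops at an open cell.\<close>
lemma point_in_open_cell:
  assumes "T \<in> cells K" "x \<in> T"
  obtains S where "subcell K S T" "S = T \<or> dm S < dm T" "x \<in> S - bdry K S"
  using assms
proof (induction "dm T" arbitrary: T thesis rule: less_induct)
  case less
  show ?case
  proof (cases "x \<in> bdry K T")
    case False
    then show ?thesis
      using less.prems(1)[of T] less.prems(2,3) by (simp add: subcell_def)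
  next
    case True
    then obtain T' where T': "T' \<in> cells K" "dm T' < dm T" "x \<in> T'" "T' \<subseteq> bdry K T"
      using bdry_union[OF less.prems(2)] by blast
    from less.hyps[OF T'(2) _ T'(1,3)] obtain S
      where "subcell K S T'" "S = T' \<or> dm S < dm T'" "x \<in> S - bdry K S"
      by blast
    then show ?thesis
      using T' bdry_subset[OF less.prems(2)] less.prems(1)[of S] less.prems(2)
      by (auto simp: subcell_def)
  qed
qed

lemma ssD: "S \<in> ss T \<Longrightarrow> S \<in> cells K \<and> T \<in> cells K \<and> S \<subseteq> T \<and> S \<noteq> T"
  by (simp add: strict_subcells_def subcell_def)

text \<open>A point in the open cell of \<open>S\<close> lies in the open cell of a subcell that is \<open>T\<close> or has smaller
  dimension than \<open>T\<close>. As open cells are disjoint, this subcell is \<open>S\<close>.\<close>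
lemma dm_ss:
  assumes "S \<in> ss T" shows "dm S < dm T"
proof -
  note S = ssD[OF assms]
  obtain x where x: "x \<in> S - bdry K S"
    using open_cell_nonempty[of S] S by auto
  then obtain S' where S': "subcell K S' T" "S' = T \<or> dm S' < dm T" "x \<in> S' - bdry K S'"
    using point_in_open_cell[of T x] S by blast
  then have "S' = S"
    using open_cells_disjoint[of S S'] x S by (auto simp: subcell_def)
  then show ?thesis
    using S' S by auto
qed

lemma open_cell_meets:
  assumes "T \<in> cells K" "S \<in> cells K" "x \<in> S" "x \<in> T - bdry K T"
  shows "T \<subseteq> S"
proof -
  obtain S' where "subcell K S' S" "x \<in> S' - bdry K S'"
    using point_in_open_cell[OF assms(2,3)] by blast
  then show ?thesis
    using open_cells_disjoint[OF assms(1) _ assms(4)] by (auto simp: subcell_def)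
qed

lemma bdry_eq:
  assumes "T \<in> cells K" shows "bdry K T = \<Union>(ss T)"
proof
  obtain F where F: "F \<subseteq> {S \<in> cells K. dm S < dm T}" "bdry K T = \<Union>F"
    using bdry_union[OF assms] by (elim exE conjE)
  show "bdry K T \<subseteq> \<Union>(ss T)"
  proof -
    have "S \<in> ss T" if "S \<in> F" for S
      using that F bdry_subset[OF assms] assms by (auto simp: strict_subcells_def subcell_def)
    then show ?thesis using F(2) by auto
  qed
  show "\<Union>(ss T) \<subseteq> bdry K T"
  proof (intro Union_least subsetI)
    fix S x assume S: "S \<in> ss T" "x \<in> S"
    show "x \<in> bdry K T"
      using open_cell_meets[of T S x] S ssD[OF S(1)] by blast
  qed
qed

lemma ss_trans: "\<lbrakk>S \<in> ss T; R \<in> ss S\<rbrakk> \<Longrightarrow> R \<in> ss T"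
  by (auto simp: strict_subcells_def subcell_def)

lemma subcell_iff: "T \<in> cells K \<Longrightarrow> subcell K S T \<longleftrightarrow> S \<in> cl T"
  by (auto simp: strict_subcells_def subcell_def)

lemma ss_vertex: "dm T = 0 \<Longrightarrow> ss T = {}"
  using dm_ss by fastforce

definition downclosed :: "'p set set \<Rightarrow> bool" where
  "downclosed L \<longleftrightarrow> L \<subseteq> cells K \<and> (\<forall>T\<in>L. ss T \<subseteq> L)"

lemma downclosed_ss: "downclosed (ss T)"
  unfolding downclosed_def using ss_trans by (blast dest: ssD)

lemma downclosed_cl: "T \<in> cells K \<Longrightarrow> downclosed (cl T)"
  using downclosed_ss[of T] by (auto simp: downclosed_def)

lemma compactin_cell:
  assumes "T \<in> cells K" shows "compactin X T"
proof -
  obtain h where "homeomorphic_map (subtopology (Euclidean_space (dm T)) (unit_disc (dm T)))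
      (subtopology X T) h" "h ` unit_disc (dm T) = T"
    using cell_chart[OF assms] by metis
  then have "continuous_map (top_of_set (unit_disc (dm T))) X h"
    by (auto simp: subtopology_unit_disc homeomorphic_eq_everything_map
        intro: continuous_map_into_fulltopology)
  then have "compactin X (h ` unit_disc (dm T))"
    by (rule image_compactin[rotated]) (simp add: compactin_subtopology compact_unit_disc)
  then show ?thesis
    by (simp add: \<open>h ` unit_disc (dm T) = T\<close>)
qed

lemma closedin_cell: "T \<in> cells K \<Longrightarrow> closedin X T"
  by (simp add: compactin_cell compactin_imp_closedin hausdorff)

text \<open>A cell of \<open>L\<close> that meets the open cell of \<open>T\<close> contains \<open>T\<close>, which would force \<open>T\<close> into \<open>L\<close>.\<close>
lemma cell_Int_body:
  assumes "T \<in> cells K" "downclosed L" "T \<notin> L" "ss T \<subseteq> L"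
  shows "T \<inter> \<Union>L = bdry K T"
proof
  show "bdry K T \<subseteq> T \<inter> \<Union>L"
    using assms(4) bdry_eq[OF assms(1)] bdry_subset[OF assms(1)] by blast
  show "T \<inter> \<Union>L \<subseteq> bdry K T"
  proof
    fix x assume "x \<in> T \<inter> \<Union>L"
    then obtain S where S: "S \<in> L" "x \<in> S" "x \<in> T" by blast
    then have "S \<in> cells K" "ss S \<subseteq> L" using assms(2) by (auto simp: downclosed_def)
    then have "\<not> T \<subseteq> S"
      using assms(1,3) S(1) by (auto simp: strict_subcells_def subcell_def)
    then show "x \<in> bdry K T"
      using open_cell_meets[OF assms(1) \<open>S \<in> cells K\<close> S(2)] S(3) by blast
  qed
qed

lemma attached_cell_body:
  assumes "T \<in> cells K" "finite L" "downclosed L" "T \<notin> L" "ss T \<subseteq> L"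
  obtains h where "attached_cell (body (insert T L)) T (\<Union>L) (dm T) h"
proof -
  obtain h where h: "homeomorphic_map (subtopology (Euclidean_space (dm T)) (unit_disc (dm T)))
      (subtopology X T) h" "h ` unit_sphere (dm T) = bdry K T"
    using cell_chart[OF assms(1)] by metis
  have cells: "L \<subseteq> cells K" using assms(3) by (simp add: downclosed_def)
  have "closedin X (\<Union>L)"
    using assms(2) cells closedin_cell by (intro closedin_Union) auto
  have "attached_cell (body (insert T L)) T (\<Union>L) (dm T) h"
  proof (rule attached_cell.intro)
    show "closedin (body (insert T L)) T" "closedin (body (insert T L)) (\<Union>L)"
      using closedin_cell[OF assms(1)] \<open>closedin X (\<Union>L)\<close>
      by (auto intro: closedin_subset_topspace)
    have "\<Union>(insert T L) \<subseteq> topspace X"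
      using cells assms(1) closedin_cell closedin_subset by blast
    then show "T \<union> \<Union>L = topspace (body (insert T L))"
      by auto
    have "subtopology (body (insert T L)) T = subtopology X T"
      by (simp add: subtopology_subtopology inf.absorb2)
    then show "homeomorphic_map (subtopology (Euclidean_space (dm T)) (unit_disc (dm T)))
        (subtopology (body (insert T L)) T) h"
      using h(1) by simp
    show "h ` unit_sphere (dm T) = T \<inter> \<Union>L"
      using h(2) cell_Int_body[OF assms(1,3,4,5)] by simp
  qed
  then show thesis by (rule that)
qed

lemma contractible_cell:
  assumes "T \<in> cells K" shows "contractible_space (subtopology X T)"
proof -
  obtain h where "homeomorphic_map (top_of_set (unit_disc (dm T))) (subtopology X T) h"
    using cell_chart[OF assms] by (metis subset_refl subtopology_unit_disc)
  then show ?thesis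
    using contractible_unit_disc homeomorphic_map_imp_homeomorphic_space
      homeomorphic_space_contractibility by blast
qed

lemma reduced_cycle_in_cell_bounds:
  "\<lbrakk>T \<in> cells K; reduced_cycle p (subtopology X T) c\<rbrakk> \<Longrightarrow> bounds p (subtopology X T) c"
  using reduced_cycle_bounds_if_trivial trivial_reduced_homology_group_contractible_space
    contractible_cell by blast

lemma boundary_sphere:
  assumes "T \<in> cells K" "dm T = Suc m"
  shows "nsphere m homeomorphic_space body (ss T)"
proof -
  obtain h where h: "homeomorphic_map (subtopology (Euclidean_space (Suc m)) (unit_disc (Suc m)))
      (subtopology X T) h" "h ` unit_sphere (Suc m) = bdry K T"
    using cell_chart[OF assms(1)] assms(2) by metis
  have "subtopology (subtopology X T) (bdry K T) = body (ss T)"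
    using bdry_subset[OF assms(1)] bdry_eq[OF assms(1)]
    by (simp add: subtopology_subtopology inf.absorb2)
  then show ?thesis
    using homeomorphic_boundary_sphere[OF h(1)] h(2) by simp
qed

lemma reduced_homology_boundary_sphere:
  assumes "T \<in> cells K" "dm T = Suc m"
  shows "reduced_homology_group (int m) (body (ss T)) \<cong> integer_group"
    and "p \<noteq> m \<Longrightarrow> trivial_group (reduced_homology_group (int p) (body (ss T)))"
proof -
  have iso: "reduced_homology_group i (nsphere m) \<cong> reduced_homology_group i (body (ss T))" for i
    using homeomorphic_space_imp_isomorphic_reduced_homology_groups[OF boundary_sphere[OF assms]] .
  show "reduced_homology_group (int m) (body (ss T)) \<cong> integer_group"
    using iso reduced_homology_group_nsphere(1) group.iso_sym group_reduced_homology_group iso_trans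
    by blast
  show "trivial_group (reduced_homology_group (int p) (body (ss T)))" if "p \<noteq> m"
    using iso reduced_homology_group_nsphere(2)[of "int p" m] that isomorphic_group_triviality
      group_reduced_homology_group by (metis of_nat_eq_iff)
qed

lemma vertex_exists:
  assumes "T \<in> cells K" obtains v where "v \<in> cl T" "dm v = 0"
  using assms
proof (induction "dm T" arbitrary: T thesis rule: less_induct)
  case less
  show ?case
  proof (cases "dm T")
    case 0
    then show ?thesis using less.prems(1)[of T] by simp
  next
    case (Suc m)
    have "body (ss T) \<noteq> trivial_topology"
      using homeomorphic_empty_space[OF boundary_sphere[OF less.prems(2) Suc]] by simp
    then obtain S where S: "S \<in> ss T"
      by (cases "ss T = {}") auto
    have "S \<in> cells K" using ssD[OF S] by simp
    obtain v where v: "v \<in> cl S" "dm v = 0"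
      by (rule less.hyps[OF dm_ss[OF S] _ \<open>S \<in> cells K\<close>])
    have "v \<in> cl T" using v(1) S ss_trans[OF S] by auto
    then show ?thesis
      using less.prems(1) v(2) by simp
  qed
qed

section \<open>Cellular chains and their singular realization\<close>


text \<open>The degree is an integer, so that in degree \<open>-1\<close> only the zero chain exists and the bottom of the
  complex is not an exceptional case.\<close>
definition cellular_chain :: "'p set set \<Rightarrow> int \<Rightarrow> ('p set \<Rightarrow>\<^sub>0 int) \<Rightarrow> bool" where
  "cellular_chain L k z \<longleftrightarrow> Poly_Mapping.keys z \<subseteq> {T \<in> L. int (dm T) = k}"

definition cell_boundary :: "'p set \<Rightarrow> 'p set \<Rightarrow>\<^sub>0 int" where
  "cell_boundary T = (\<Sum>S\<in>ss T. frag_cmul (orient K T S) (frag_of S))"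

definition cellular_boundary :: "('p set \<Rightarrow>\<^sub>0 int) \<Rightarrow> 'p set \<Rightarrow>\<^sub>0 int" where
  "cellular_boundary = frag_extend cell_boundary"

lemma cellular_boundary_simps [simp]:
  "cellular_boundary 0 = 0" "cellular_boundary (frag_of T) = cell_boundary T" "cellular_boundary (a + b) = cellular_boundary a + cellular_boundary b" "cellular_boundary (a - b) = cellular_boundary a - cellular_boundary b"
  "cellular_boundary (- a) = - cellular_boundary a" "cellular_boundary (frag_cmul j a) = frag_cmul j (cellular_boundary a)"
  by (simp_all add: cellular_boundary_def frag_extend_add frag_extend_diff frag_extend_minus frag_extend_cmul)

lemma cellular_chain_0 [simp]: "cellular_chain L k 0"
  by (simp add: cellular_chain_def)

lemma cellular_chain_of: "cellular_chain L k (frag_of T) \<longleftrightarrow> T \<in> L \<and> int (dm T) = k"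
  by (simp add: cellular_chain_def)

lemma cellular_chain_minus [simp]: "cellular_chain L k (- a) \<longleftrightarrow> cellular_chain L k a"
  by (simp add: cellular_chain_def)

lemma cellular_chain_cmul: "cellular_chain L k a \<Longrightarrow> cellular_chain L k (frag_cmul j a)"
  unfolding cellular_chain_def using keys_cmul by blast

lemma cellular_chain_add:
  "\<lbrakk>cellular_chain L k a; cellular_chain L k b\<rbrakk> \<Longrightarrow> cellular_chain L k (a + b)"
  unfolding cellular_chain_def using keys_add[of a b] by blast

lemma cellular_chain_diff:
  "\<lbrakk>cellular_chain L k a; cellular_chain L k b\<rbrakk> \<Longrightarrow> cellular_chain L k (a - b)"
  unfolding cellular_chain_def using keys_diff[of a b] by blast

lemma cellular_chain_mono: "\<lbrakk>cellular_chain L k a; L \<subseteq> M\<rbrakk> \<Longrightarrow> cellular_chain M k a"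
  unfolding cellular_chain_def by blast

lemma cellular_chain_induct [consumes 1, case_names zero cell diff]:
  assumes "cellular_chain L k z" "P 0" "\<And>T. \<lbrakk>T \<in> L; int (dm T) = k\<rbrakk> \<Longrightarrow> P (frag_of T)"
    "\<And>a b. \<lbrakk>cellular_chain L k a; cellular_chain L k b; P a; P b\<rbrakk> \<Longrightarrow> P (a - b)"
  shows "P z"
proof -
  have "cellular_chain L k z \<and> P z"
    using assms(1) unfolding cellular_chain_def
  proof (induction z rule: frag_induction)
    case (diff a b)
    then show ?case
      using assms(4)[of a b] keys_diff[of a b] unfolding cellular_chain_def by blast
  qed (use assms(2,3) in auto)
  then show ?thesis ..
qed

lemma cellular_chain_extend:
  assumes "cellular_chain L k z" "\<And>T. \<lbrakk>T \<in> L; int (dm T) = k\<rbrakk> \<Longrightarrow> cellular_chain M j (f T)"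
  shows "cellular_chain M j (frag_extend f z)"
  using assms(1)
  by (induction rule: cellular_chain_induct) (simp_all add: assms(2) frag_extend_diff cellular_chain_diff)

lemma orient_nonzero: "\<lbrakk>S \<in> ss T; orient K T S \<noteq> 0\<rbrakk> \<Longrightarrow> dm T = Suc (dm S)"
  using oriented unfolding relative_orientation_def by (metis ssD)

lemma orient_unit:
  assumes "S \<in> ss T" "dm T = Suc (dm S)" shows "orient K T S = 1 \<or> orient K T S = -1"
proof -
  have "subcell K S T" using assms(1) by (simp add: strict_subcells_def)
  then show ?thesis
    using oriented ssD[OF assms(1)] assms(2) unfolding relative_orientation_def by blast
qed

lemma orient_outside:
  assumes "S \<in> cells K" "T \<in> cells K" "S \<notin> ss T" shows "orient K T S = 0"
proof -
  have "\<not> (subcell K S T \<and> dm T = Suc (dm S))"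
    using assms(3) by (auto simp: strict_subcells_def)
  then show ?thesis
    using oriented assms(1,2) unfolding relative_orientation_def by blast
qed

lemma orient_square:
  "\<lbrakk>T \<in> cells K; R \<in> cells K\<rbrakk> \<Longrightarrow> (\<Sum>S\<in>ss T. orient K T S * orient K S R) = 0"
  using oriented unfolding relative_orientation_def by blast

lemma orient_edge: "\<lbrakk>T \<in> cells K; dm T = 1\<rbrakk> \<Longrightarrow> (\<Sum>S\<in>ss T. orient K T S) = 0"
  using oriented unfolding relative_orientation_def by blast

lemma lookup_cell_boundary:
  assumes "T \<in> cells K"
  shows "Poly_Mapping.lookup (cell_boundary T) S = (if S \<in> ss T then orient K T S else 0)"
  using finite_ss[OF assms] by (simp add: cell_boundary_def lookup_sum if_distrib cong: if_cong)

lemma cellular_chain_cell_boundary: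
  assumes "T \<in> cells K" shows "cellular_chain (ss T) (int (dm T) - 1) (cell_boundary T)"
  unfolding cellular_chain_def
proof
  fix S assume "S \<in> Poly_Mapping.keys (cell_boundary T)"
  then have "S \<in> ss T" "orient K T S \<noteq> 0"
    using lookup_cell_boundary[OF assms, of S] by (auto simp: in_keys_iff split: if_splits)
  then show "S \<in> {S \<in> ss T. int (dm S) = int (dm T) - 1}"
    using orient_nonzero by simp
qed

lemma cellular_chain_cellular_boundary:
  assumes "downclosed L" "cellular_chain L k z"
  shows "cellular_chain L (k - 1) (cellular_boundary z)"
  unfolding cellular_boundary_def
proof (rule cellular_chain_extend[OF assms(2)])
  fix T assume T: "T \<in> L" "int (dm T) = k"
  then have "T \<in> cells K" "ss T \<subseteq> L" using assms(1) by (auto simp: downclosed_def)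
  then show "cellular_chain L (k - 1) (cell_boundary T)"
    using cellular_chain_cell_boundary cellular_chain_mono T(2) by blast
qed

lemma cellular_boundary_cell_boundary:
  assumes "T \<in> cells K" shows "cellular_boundary (cell_boundary T) = 0"
proof (rule poly_mapping_eqI)
  fix R
  have "Poly_Mapping.lookup (cellular_boundary (cell_boundary T)) R = (\<Sum>S\<in>ss T. orient K T S * Poly_Mapping.lookup (cell_boundary S) R)"
    unfolding cell_boundary_def[of T] cellular_boundary_def
    by (simp add: frag_extend_sum[OF finite_ss[OF assms]] frag_extend_cmul lookup_sum)
  also have "\<dots> = 0"
  proof (cases "R \<in> cells K")
    case True
    have "Poly_Mapping.lookup (cell_boundary S) R = orient K S R" if "S \<in> ss T" for S
      using lookup_cell_boundary[of S R] orient_outside[OF True, of S] ssD[OF that] by auto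
    then show ?thesis
      using orient_square[OF assms True] by simp
  next
    case False
    have "Poly_Mapping.lookup (cell_boundary S) R = 0" if "S \<in> ss T" for S
    proof -
      have "R \<notin> ss S" using False ssD by blast
      then show ?thesis using lookup_cell_boundary[of S R] ssD[OF that] by simp
    qed
    then show ?thesis by simp
  qed
  finally show "Poly_Mapping.lookup (cellular_boundary (cell_boundary T)) R = Poly_Mapping.lookup 0 R" by simp
qed

lemma cellular_boundary_cellular_boundary:
  assumes "downclosed L" "cellular_chain L k z" shows "cellular_boundary (cellular_boundary z) = 0"
  using assms(2)
proof (induction rule: cellular_chain_induct)
  case (cell T)
  then show ?case using cellular_boundary_cell_boundary assms(1) by (auto simp: downclosed_def)
qed simp_all

lemma cell_boundary_vertex: "dm T = 0 \<Longrightarrow> cell_boundary T = 0"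
  by (simp add: cell_boundary_def ss_vertex)

lemma augmentation_cell_boundary: "\<lbrakk>T \<in> cells K; dm T = 1\<rbrakk> \<Longrightarrow> augmentation (cell_boundary T) = 0"
  by (simp add: cell_boundary_def augmentation_sum orient_edge)

text \<open>Acyclic carriers: a \<open>p\<close>-cell is realized by a singular chain in the cell itself whose boundary is
  the realization of the cellular boundary.\<close>
primrec cell_simplex :: "nat \<Rightarrow> 'p set \<Rightarrow> 'p chain" where
  "cell_simplex 0 T = (SOME c. \<exists>f. c = frag_of f \<and> singular_simplex 0 (subtopology X T) f)"
| "cell_simplex (Suc p) T = (SOME c. singular_chain (Suc p) (subtopology X T) c \<and>
     chain_boundary (Suc p) c = frag_extend (cell_simplex p) (cell_boundary T))"

declare cell_simplex.simps [simp del]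

definition to_singular :: "nat \<Rightarrow> ('p set \<Rightarrow>\<^sub>0 int) \<Rightarrow> 'p chain" where
  "to_singular p = frag_extend (cell_simplex p)"

lemma to_singular_simps [simp]:
  "to_singular p 0 = 0" "to_singular p (frag_of T) = cell_simplex p T" "to_singular p (a + b) = to_singular p a + to_singular p b"
  "to_singular p (a - b) = to_singular p a - to_singular p b" "to_singular p (- a) = - to_singular p a"
  "to_singular p (frag_cmul j a) = frag_cmul j (to_singular p a)"
  by (simp_all add: to_singular_def frag_extend_add frag_extend_diff frag_extend_minus frag_extend_cmul)

lemma singular_chain_body_mono:
  "\<lbrakk>singular_chain p (body L) c; L \<subseteq> M\<rbrakk> \<Longrightarrow> singular_chain p (body M) c"
  by (rule singular_chain_mono) auto

lemma singular_chain_cell_body: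
  "\<lbrakk>singular_chain p (subtopology X T) c; T \<in> L\<rbrakk> \<Longrightarrow> singular_chain p (body L) c"
  by (rule singular_chain_mono) auto

lemma body_cl: "T \<in> cells K \<Longrightarrow> body (cl T) = subtopology X T"
proof -
  assume "T \<in> cells K"
  have "\<Union>(cl T) = T" using ssD by fastforce
  then show ?thesis by simp
qed

lemma cell_simplex_0:
  assumes "T \<in> cells K"
  obtains f where "cell_simplex 0 T = frag_of f" "singular_simplex 0 (subtopology X T) f"
proof -
  obtain x where x: "x \<in> T" using open_cell_nonempty[OF assms] by blast
  have "x \<in> topspace X" using x closedin_cell[OF assms] closedin_subset by blast
  then have "singular_simplex 0 (subtopology X T) (restrict (\<lambda>_. x) (standard_simplex 0))"
    using x by (auto simp: singular_simplex_def intro!: continuous_map_eq[of _ _ "\<lambda>_. x"])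
  then have "\<exists>c. \<exists>f. c = frag_of f \<and> singular_simplex 0 (subtopology X T) f" by blast
  from someI_ex[OF this] show thesis
    using that unfolding cell_simplex.simps by blast
qed

text \<open>The realized boundary of \<open>T\<close> is a cycle in \<open>T\<close>, because the cellular boundary squares to zero; so it
  bounds in the contractible \<open>T\<close>. For an edge one also has to know that the augmentation vanishes, and
  this is the sign condition on its endpoints.\<close>
lemma cell_simplex:
  "\<lbrakk>T \<in> cells K; dm T = p\<rbrakk> \<Longrightarrow> singular_chain p (subtopology X T) (cell_simplex p T) \<and>
     chain_boundary p (cell_simplex p T) = to_singular (p - 1) (cell_boundary T)"
proof (induction p arbitrary: T)
  case 0
  obtain f where "cell_simplex 0 T = frag_of f" "singular_simplex 0 (subtopology X T) f"
    using cell_simplex_0[OF 0(1)] .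
  then show ?case
    using cell_boundary_vertex[OF 0(2)] by (simp add: singular_chain_of chain_boundary_of)
next
  case (Suc p)
  let ?c = "to_singular p (cell_boundary T)"
  have cell_boundary: "cellular_chain (ss T) (int p) (cell_boundary T)"
    using cellular_chain_cell_boundary[OF Suc.prems(1)] Suc.prems(2) by simp
  have IH: "singular_chain p (subtopology X T) (cell_simplex p S) \<and>
      chain_boundary p (cell_simplex p S) = to_singular (p - 1) (cell_boundary S)"
    if "S \<in> ss T" "int (dm S) = int p" for S
    using Suc.IH[of S] that ssD[OF that(1)] singular_chain_mono[of p X S _ T] by auto
  have sing: "singular_chain p (subtopology X T) (to_singular p z)"
    and bdry: "chain_boundary p (to_singular p z) = to_singular (p - 1) (cellular_boundary z)"
    if "cellular_chain (ss T) (int p) z" for z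
  proof -
    have "singular_chain p (subtopology X T) (to_singular p z) \<and> chain_boundary p (to_singular p z) = to_singular (p - 1) (cellular_boundary z)"
      using that
      by (induction rule: cellular_chain_induct) (simp_all add: IH singular_chain_diff chain_boundary_diff)
    then show "singular_chain p (subtopology X T) (to_singular p z)"
      and "chain_boundary p (to_singular p z) = to_singular (p - 1) (cellular_boundary z)" by auto
  qed
  have "augmentation ?c = 0" if "p = 0"
  proof -
    have 1: "augmentation (cell_simplex p S) = 1" if "S \<in> Poly_Mapping.keys (cell_boundary T)" for S
    proof -
      have "S \<in> cells K" using that cell_boundary ssD by (auto simp: cellular_chain_def)
      then show ?thesis using cell_simplex_0[of S] \<open>p = 0\<close> by (metis augmentation_simps(2))
    qed
    have "augmentation ?c = augmentation (cell_boundary T)"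
      unfolding to_singular_def using augmentation_frag_extend[OF 1] by simp
    then show ?thesis
      using augmentation_cell_boundary[OF Suc.prems(1)] Suc.prems(2) that by simp
  qed
  then have "reduced_cycle p (subtopology X T) ?c"
    using sing[OF cell_boundary] bdry[OF cell_boundary] cellular_boundary_cell_boundary[OF Suc.prems(1)] by (simp add: reduced_cycle_def)
  then have "bounds p (subtopology X T) ?c"
    using reduced_cycle_in_cell_bounds[OF Suc.prems(1)] by blast
  then have "\<exists>c. singular_chain (Suc p) (subtopology X T) c \<and>
     chain_boundary (Suc p) c = frag_extend (cell_simplex p) (cell_boundary T)"
    by (simp add: bounds_def to_singular_def)
  from someI_ex[OF this] show ?case
    by (simp add: to_singular_def cell_simplex.simps)
qed

lemma augmentation_to_singular_0:
  assumes "downclosed L" "cellular_chain L 0 z" shows "augmentation (to_singular 0 z) = augmentation z"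
  using assms(2)
proof (induction rule: cellular_chain_induct)
  case (cell T)
  then have "T \<in> cells K" using assms(1) by (auto simp: downclosed_def)
  then show ?case using cell_simplex_0[of T] by (metis augmentation_simps(2) to_singular_simps(2))
qed simp_all

lemma singular_chain_to_singular:
  assumes "downclosed L" "cellular_chain L (int p) z"
  shows "singular_chain p (body L) (to_singular p z)"
  using assms(2)
proof (induction rule: cellular_chain_induct)
  case (cell T)
  then have "T \<in> cells K" using assms(1) by (auto simp: downclosed_def)
  then show ?case
    using cell_simplex[of T p] cell singular_chain_cell_body[of p T "cell_simplex p T" L] by simp
qed (simp_all add: singular_chain_diff)

lemma chain_boundary_to_singular:
  assumes "downclosed L" "cellular_chain L (int p) z"
  shows "chain_boundary p (to_singular p z) = to_singular (p - 1) (cellular_boundary z)"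
  using assms(2)
proof (induction rule: cellular_chain_induct)
  case (cell T)
  then have "T \<in> cells K" using assms(1) by (auto simp: downclosed_def)
  then show ?case
    using cell_simplex[of T p] cell by simp
qed (simp_all add: chain_boundary_diff)

text \<open>Exactness of the mapping cone of the realization. For \<open>z = 0\<close> it states surjectivity in homology
  of degree \<open>p\<close>, and the existence of \<open>w\<close> is injectivity in degree \<open>p - 1\<close>. For \<open>p = 0\<close> the chain \<open>z\<close>
  vanishes, so the truncated difference \<open>p - 1\<close> of natural numbers does no harm.\<close>
definition comparison :: "'p set set \<Rightarrow> bool" where
  "comparison L \<longleftrightarrow> (\<forall>p s z. singular_chain p (body L) s \<and> cellular_chain L (int p - 1) z \<and>
     cellular_boundary z = 0 \<and> chain_boundary p s = to_singular (p - 1) z \<longrightarrow>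
     (\<exists>w t. cellular_chain L (int p) w \<and> singular_chain (Suc p) (body L) t \<and>
        cellular_boundary w = z \<and> s = to_singular p w + chain_boundary (Suc p) t))"

lemma comparisonD:
  assumes "comparison L" "singular_chain p (body L) s" "cellular_chain L (int p - 1) z"
    "cellular_boundary z = 0" "chain_boundary p s = to_singular (p - 1) z"
  obtains w t where "cellular_chain L (int p) w" "singular_chain (Suc p) (body L) t"
    "cellular_boundary w = z" "s = to_singular p w + chain_boundary (Suc p) t"
  using assms unfolding comparison_def by blast

definition acyclic :: "'p set \<Rightarrow> bool" where
  "acyclic T \<longleftrightarrow> (\<forall>k z. cellular_chain (cl T) k z \<and> cellular_boundary z = 0 \<and> (k = 0 \<longrightarrow> augmentation z = 0) \<longrightarrow>
     (\<exists>w. cellular_chain (cl T) (k + 1) w \<and> cellular_boundary w = z))"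

text \<open>Both complexes have the reduced homology of a point: first \<open>z\<close> is filled by a cellular chain, then
  the rest of \<open>s\<close> is a singular cycle in a contractible space. In degree 0 a multiple of a vertex is
  needed to make its augmentation vanish.\<close>
lemma comparison_cell:
  assumes T: "T \<in> cells K" and acyc: "acyclic T"
  shows "comparison (cl T)"
  unfolding comparison_def
proof (intro allI impI, elim conjE)
  fix p s z
  assume s: "singular_chain p (body (cl T)) s" and z: "cellular_chain (cl T) (int p - 1) z"
    and "cellular_boundary z = 0" and bs: "chain_boundary p s = to_singular (p - 1) z"
  note down = downclosed_cl[OF T]
  have "augmentation z = 0" if "int p - 1 = 0"
    using augmentation_to_singular_0[OF down, of z] z that bs augmentation_chain_boundary_1[of s] by simp
  then obtain w0 where w0: "cellular_chain (cl T) (int p) w0" "cellular_boundary w0 = z"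
    using acyc z \<open>cellular_boundary z = 0\<close> unfolding acyclic_def by (metis diff_add_cancel)
  obtain v where v: "v \<in> cl T" "dm v = 0"
    by (rule vertex_exists[OF T])
  let ?s = "s - to_singular p w0"
  define w where "w = w0 + (if p = 0 then frag_cmul (augmentation ?s) (frag_of v) else 0)"
  have w: "cellular_chain (cl T) (int p) w"
    unfolding w_def using w0(1) v by (auto intro!: cellular_chain_add cellular_chain_cmul simp: cellular_chain_of)
  have bw: "cellular_boundary w = z"
    using w0(2) cell_boundary_vertex[OF v(2)] by (simp add: w_def)
  have "augmentation (s - to_singular p w) = 0" if "p = 0"
  proof -
    have "augmentation (to_singular 0 (frag_cmul (augmentation ?s) (frag_of v))) = augmentation ?s"
      using augmentation_to_singular_0[OF down, of "frag_cmul (augmentation ?s) (frag_of v)"] v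
      by (simp add: cellular_chain_of cellular_chain_cmul)
    then show ?thesis
      using that by (auto simp: w_def)
  qed
  moreover have "chain_boundary p (s - to_singular p w) = 0"
    using bs chain_boundary_to_singular[OF down w] bw by (simp add: chain_boundary_diff)
  moreover have "singular_chain p (body (cl T)) (s - to_singular p w)"
    using s singular_chain_to_singular[OF down w] by (rule singular_chain_diff)
  ultimately have "bounds p (subtopology X T) (s - to_singular p w)"
    using reduced_cycle_in_cell_bounds[OF T] by (simp only: reduced_cycle_def body_cl[OF T]) blast
  then obtain t where t: "singular_chain (Suc p) (body (cl T)) t"
      "chain_boundary (Suc p) t = s - to_singular p w"
    unfolding bounds_def body_cl[OF T] by blast
  show "\<exists>w t. cellular_chain (cl T) (int p) w \<and> singular_chain (Suc p) (body (cl T)) t \<and>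
      cellular_boundary w = z \<and> s = to_singular p w + chain_boundary (Suc p) t"
    by (intro exI[of _ w] exI[of _ t]) (use w bw t in simp)
qed

section \<open>Cellular homology of a cell\<close>


lemma cellular_chain_neg: "\<lbrakk>cellular_chain L k z; k < 0\<rbrakk> \<Longrightarrow> z = 0"
proof -
  assume "cellular_chain L k z" "k < 0"
  then have "Poly_Mapping.keys z = {}" by (auto simp: cellular_chain_def)
  then show "z = 0" by simp
qed

lemma singular_chain_to_singular_nat:
  assumes "downclosed L" "cellular_chain L k z" "nat k = q"
  shows "singular_chain q (body L) (to_singular q z)"
  using singular_chain_to_singular[OF assms(1), of q z] cellular_chain_neg[OF assms(2)] assms(2,3)
  by (cases "k < 0") auto

lemma chain_boundary_to_singular_nat:
  assumes "downclosed L" "cellular_chain L k z" "nat k = q"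
  shows "chain_boundary q (to_singular q z) = to_singular (q - 1) (cellular_boundary z)"
  using chain_boundary_to_singular[OF assms(1), of q z] cellular_chain_neg[OF assms(2)] assms(2,3)
  by (cases "k < 0") auto

lemma cellular_chain_Int:
  "\<lbrakk>cellular_chain L k z; cellular_chain M k z\<rbrakk> \<Longrightarrow> cellular_chain (L \<inter> M) k z"
  unfolding cellular_chain_def by blast

text \<open>The five lemma for the pairs \<open>(T, \<partial>T)\<close> and \<open>(L \<union> T, L)\<close>, as a chase. Modulo \<open>L\<close> the cone cycle
  \<open>(s, z)\<close> is moved into \<open>T\<close> by excision; there it is corrected along \<open>\<partial>T\<close> to an absolute cone cycle and
  filled; what remains is a cone cycle of \<open>L\<close>.\<close>
lemma comparison_insert:
  assumes T: "T \<in> cells K" "T \<notin> L" "ss T \<subseteq> L" and L: "finite L" "downclosed L"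
    and cmpL: "comparison L" and cmpb: "comparison (ss T)" and cmpT: "comparison (cl T)"
  shows "comparison (insert T L)"
  unfolding comparison_def
proof (intro allI impI, elim conjE)
  fix p s z
  let ?M = "insert T L"
  assume s: "singular_chain p (body ?M) s" and z: "cellular_chain ?M (int p - 1) z"
    and bz: "cellular_boundary z = 0" and bs: "chain_boundary p s = to_singular (p - 1) z"
  obtain h where "attached_cell (body ?M) T (\<Union>L) (dm T) h"
    by (rule attached_cell_body[OF T(1) L T(2,3)])
  then interpret att: attached_cell "body ?M" T "\<Union>L" "dm T" h .
  have subT: "subtopology (body ?M) T = subtopology X T"
    and subL: "subtopology (body ?M) (\<Union>L) = body L"
    by (simp_all add: subtopology_subtopology inf.absorb2 Int_absorb1)
  have TL: "T \<inter> \<Union>L = \<Union>(ss T)"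
    using cell_Int_body[OF T(1) L(2) T(2,3)] bdry_eq[OF T(1)] by simp
  have "T \<inter> \<Union>(ss T) = \<Union>(ss T)" using TL by blast
  then have subTL: "subtopology (subtopology X T) (T \<inter> \<Union>L) = body (ss T)"
    by (simp add: subtopology_subtopology TL)
  note bodyT = body_cl[OF T(1)]
  note dT = downclosed_cl[OF T(1)] and db = downclosed_ss[of T]
  have clM: "cl T \<subseteq> ?M" using T(3) by blast
  have inL: "singular_chain q (body L) c" if "singular_chain q (body (ss T)) c" for q c
    using that T(3) by (rule singular_chain_body_mono)
  have binT: "singular_chain q (body (cl T)) c" if "singular_chain q (body (ss T)) c" for q c
    using that by (rule singular_chain_body_mono) blast
  have inM: "singular_chain q (body ?M) c" if "singular_chain q (body (cl T)) c" for q c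
    using that clM by (rule singular_chain_body_mono)
  obtain zT zL where zT: "cellular_chain (cl T) (int p - 1) zT"
    and zL: "cellular_chain L (int p - 1) zL" and zz: "zT + zL = z"
  proof -
    have "Poly_Mapping.keys z \<subseteq> {S \<in> cl T. int (dm S) = int p - 1} \<union> {S \<in> L. int (dm S) = int p - 1}"
      using z by (auto simp: cellular_chain_def)
    from frag_split[OF this] show thesis
      using that unfolding cellular_chain_def by blast
  qed
  have "cellular_boundary zT = - cellular_boundary zL"
    using bz zz by (metis cellular_boundary_simps(3) eq_neg_iff_add_eq_0)
  then have bzT: "cellular_chain (ss T) (int p - 1 - 1) (cellular_boundary zT)"
  proof -
    have "cellular_chain (cl T \<inter> L) (int p - 1 - 1) (cellular_boundary zT)"
      using cellular_chain_cellular_boundary[OF dT zT] cellular_chain_cellular_boundary[OF L(2) zL] \<open>cellular_boundary zT = - cellular_boundary zL\<close>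
      by (intro cellular_chain_Int) simp_all
    then show ?thesis
      by (rule cellular_chain_mono) (use T(2) in blast)
  qed
  define c where "c = to_singular (p - 1) zT"
  have c: "singular_chain (p - 1) (body (cl T)) c"
    "chain_boundary (p - 1) c = to_singular (p - 1 - 1) (cellular_boundary zT)"
    using singular_chain_to_singular_nat[OF dT zT, of "p - 1"] chain_boundary_to_singular_nat[OF dT zT, of "p - 1"]
    by (simp_all add: c_def nat_diff_distrib)
  have bc: "singular_chain (p - 1 - 1) (body (ss T)) (to_singular (p - 1 - 1) (cellular_boundary zT))"
    using singular_chain_to_singular_nat[OF db bzT, of "p - 1 - 1"] by (simp add: nat_diff_distrib)
  have pzL: "singular_chain (p - 1) (body L) (to_singular (p - 1) zL)"
    using singular_chain_to_singular_nat[OF L(2) zL, of "p - 1"] by (simp add: nat_diff_distrib)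
  have bs': "chain_boundary p s = c + to_singular (p - 1) zL"
    by (simp add: bs c_def flip: zz)
  \<comment> \<open>The realized part of \<open>z\<close> on \<open>T\<close> bounds in \<open>(L \<union> T, L)\<close> by \<open>s\<close>, hence already in \<open>(T, \<partial>T)\<close>.\<close>
  obtain sT e where sT: "singular_chain p (body (cl T)) sT" and e: "singular_chain (p - 1) (body (ss T)) e"
    and bsT: "chain_boundary p sT = c + e"
  proof (cases p)
    case 0
    then have "c = 0" using cellular_chain_neg[OF zT] by (simp add: c_def)
    then show ?thesis using that[of 0 0] by simp
  next
    case (Suc q)
    have "singular_relcycle (p - 1) (subtopology (body ?M) T) (T \<inter> \<Union>L) c"
      using c(1)[unfolded bodyT] bc unfolding singular_relcycle subT subTL c(2) by simp
    moreover have "singular_relboundary (p - 1) (body ?M) (\<Union>L) c"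
      unfolding singular_relboundary_alt subL
      using s bs' pzL Suc by (intro exI[of _ s] exI[of _ "to_singular (p - 1) zL"]) simp
    ultimately have "singular_relboundary (p - 1) (subtopology X T) (T \<inter> \<Union>L) c"
      using att.relboundary_supported_on_cell by (simp only: subT)
    then show ?thesis
      using that Suc unfolding singular_relboundary_alt subTL bodyT by auto
  qed
  \<comment> \<open>The difference is a relative cycle, which can be replaced by one in \<open>T\<close>.\<close>
  let ?r = "s - sT"
  have br: "chain_boundary p ?r = to_singular (p - 1) zL - e"
    by (simp add: chain_boundary_diff bs' bsT)
  have "singular_relcycle p (body ?M) (\<Union>L) ?r"
    unfolding singular_relcycle subL br using s inM[OF sT] pzL inL[OF e]
    by (simp add: singular_chain_diff)
  from att.relcycle_supported_on_cell[OF this] obtain d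
    where d: "singular_relcycle p (subtopology X T) (T \<inter> \<Union>L) d"
      and hd: "homologous_rel p (body ?M) (\<Union>L) ?r d"
    unfolding subT by blast
  have d1: "singular_chain p (body (cl T)) d"
    and d2: "singular_chain (p - 1) (body (ss T)) (chain_boundary p d)"
    using d unfolding singular_relcycle subTL bodyT by auto
  obtain t1 e1 where t1: "singular_chain (Suc p) (body ?M) t1" and e1: "singular_chain p (body L) e1"
    and rd: "chain_boundary (Suc p) t1 + e1 = ?r - d"
    using hd unfolding homologous_rel_def singular_relboundary subL by blast
  \<comment> \<open>Now \<open>sT + d\<close> and \<open>zT\<close> form a cone cycle of \<open>T\<close> up to an error \<open>b\<close> on \<open>\<partial>T\<close>, which is removed there.\<close>
  define b where "b = e + chain_boundary p d"
  obtain w1 t2 where w1: "cellular_chain (ss T) (int p - 1) w1" and t2: "singular_chain p (body (ss T)) t2"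
    and bw1: "cellular_boundary w1 = - cellular_boundary zT" and b: "b = to_singular (p - 1) w1 + chain_boundary p t2"
  proof (cases p)
    case 0
    then have "b = 0"
      using bsT cellular_chain_neg[OF zT] by (simp add: b_def c_def chain_boundary_def)
    then show ?thesis
      using that[of 0 0] cellular_chain_neg[OF zT] 0 by simp
  next
    case (Suc q)
    have b1: "singular_chain q (body (ss T)) b"
      unfolding b_def using e d2 Suc by (intro singular_chain_add) simp_all
    have eb: "b = chain_boundary p (sT + d) - c"
      by (simp add: b_def chain_boundary_add bsT)
    have "chain_boundary q (chain_boundary p (sT + d)) = 0"
      using chain_boundary_boundary_alt[of q "body (cl T)" "sT + d"] sT d1 Suc singular_chain_add
      by metis
    then have b2: "chain_boundary q b = to_singular (q - 1) (- cellular_boundary zT)"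
      using c(2) Suc by (simp add: eb chain_boundary_diff)
    have "cellular_chain (ss T) (int q - 1) (- cellular_boundary zT)"
      using bzT Suc by simp
    moreover have "cellular_boundary (- cellular_boundary zT) = 0"
      using cellular_boundary_cellular_boundary[OF dT zT] by simp
    ultimately show ?thesis
      using comparisonD[OF cmpb b1 _ _ b2] that Suc by auto
  qed
  let ?s1 = "sT + d - t2"
  have "singular_chain p (body (cl T)) ?s1"
    using sT d1 binT[OF t2] by (intro singular_chain_diff singular_chain_add)
  moreover have "cellular_chain (cl T) (int p - 1) (zT + w1)"
    using zT cellular_chain_mono[OF w1] by (intro cellular_chain_add) blast+
  moreover have "cellular_boundary (zT + w1) = 0"
    by (simp add: bw1)
  moreover have "chain_boundary p ?s1 = to_singular (p - 1) (zT + w1)"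
    using b by (simp add: chain_boundary_diff chain_boundary_add bsT b_def c_def algebra_simps)
  ultimately obtain w t3 where w: "cellular_chain (cl T) (int p) w"
    and t3: "singular_chain (Suc p) (body (cl T)) t3"
    and bw: "cellular_boundary w = zT + w1" and s1: "?s1 = to_singular p w + chain_boundary (Suc p) t3"
    by (rule comparisonD[OF cmpT])
  \<comment> \<open>After the filling in \<open>T\<close> has been subtracted, only a cone cycle of \<open>L\<close> is left.\<close>
  let ?z2 = "zL - w1" and ?s2 = "t2 + e1"
  have seq: "s = ?s2 + to_singular p w + chain_boundary (Suc p) (t1 + t3)"
  proof -
    have "s = sT + d + (chain_boundary (Suc p) t1 + e1)" by (simp add: rd)
    also have "sT + d = t2 + (to_singular p w + chain_boundary (Suc p) t3)"
      using s1 by (simp add: algebra_simps)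
    finally show ?thesis by (simp add: chain_boundary_add algebra_simps)
  qed
  have "singular_chain p (body L) ?s2"
    using inL[OF t2] e1 by (rule singular_chain_add)
  moreover have "cellular_chain L (int p - 1) ?z2"
    using zL cellular_chain_mono[OF w1 T(3)] by (rule cellular_chain_diff)
  moreover have "cellular_boundary ?z2 = 0"
    using bz by (simp add: bw1 add.commute flip: zz)
  moreover have "chain_boundary p ?s2 = to_singular (p - 1) ?z2"
  proof -
    have "chain_boundary p (chain_boundary (Suc p) (t1 + t3)) = 0"
      using chain_boundary_boundary_alt singular_chain_add t1 inM[OF t3] by blast
    moreover have "chain_boundary p (to_singular p w) = to_singular (p - 1) (zT + w1)"
      using chain_boundary_to_singular[OF dT w] bw by simp
    moreover have "?s2 = s - to_singular p w - chain_boundary (Suc p) (t1 + t3)"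
      by (subst seq) simp
    ultimately have "chain_boundary p ?s2 = to_singular (p - 1) z - to_singular (p - 1) (zT + w1)"
      using bs by (simp add: chain_boundary_diff)
    then show ?thesis by (simp flip: zz)
  qed
  ultimately obtain w' t' where w': "cellular_chain L (int p) w'"
    and t': "singular_chain (Suc p) (body L) t'"
    and bw': "cellular_boundary w' = ?z2" and s2: "?s2 = to_singular p w' + chain_boundary (Suc p) t'"
    by (rule comparisonD[OF cmpL])
  show "\<exists>w t. cellular_chain ?M (int p) w \<and> singular_chain (Suc p) (body ?M) t \<and>
      cellular_boundary w = z \<and> s = to_singular p w + chain_boundary (Suc p) t"
  proof (intro exI conjI)
    show "cellular_chain ?M (int p) (w + w')"
      using cellular_chain_mono[OF w clM] cellular_chain_mono[OF w', of ?M]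
      by (intro cellular_chain_add) blast+
    show "singular_chain (Suc p) (body ?M) (t1 + t3 + t')"
      using t1 inM[OF t3] singular_chain_body_mono[OF t', of ?M]
      by (intro singular_chain_add) blast+
    show "cellular_boundary (w + w') = z"
      by (simp add: bw bw' flip: zz)
    show "s = to_singular p (w + w') + chain_boundary (Suc p) (t1 + t3 + t')"
      using s2 by (subst seq) (simp add: chain_boundary_add algebra_simps)
  qed
qed

text \<open>A reduced cycle of degree \<open>k < dim T\<close> lies in the sphere \<open>\<partial>T\<close> and bounds there if \<open>k < dim T - 1\<close>. The
  cycles of degree \<open>dim T - 1\<close> in \<open>\<partial>T\<close> are the multiples of a single cycle \<open>w\<close>, since there are no
  boundaries and the top homology of the sphere is infinite cyclic. The boundary of \<open>T\<close> is \<open>j w\<close>, and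
  comparing one coefficient, which is \<open>\<plusminus>1\<close>, gives \<open>j = \<plusminus>1\<close>. So every such cycle bounds in \<open>T\<close>. In degree
  \<open>dim T\<close> a cycle is a multiple of \<open>T\<close>, and it is zero because the boundary of \<open>T\<close> is not.\<close>
lemma acyclic_if_comparison_boundary:
  assumes T: "T \<in> cells K" and cmp: "comparison (ss T)"
  shows "acyclic T"
proof (cases "dm T")
  case 0
  show ?thesis
    unfolding acyclic_def
  proof (intro allI impI, elim conjE)
    fix k z assume z: "cellular_chain (cl T) k z" and augmentation: "k = 0 \<longrightarrow> augmentation z = 0"
    have "z = 0"
    proof (cases "k = 0")
      case True
      have "Poly_Mapping.keys z \<subseteq> {T}"
        using z ss_vertex[OF 0] by (auto simp: cellular_chain_def)
      then have "Poly_Mapping.keys z = {} \<or> Poly_Mapping.keys z = {T}" by blast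
      then have "Poly_Mapping.lookup z S = (if S = T then augmentation z else 0)" for S
        by (auto simp: augmentation_def simp flip: not_in_keys_iff_lookup_eq_zero)
      then show ?thesis
        using augmentation True by (intro poly_mapping_eqI) simp
    next
      case False
      then have "int (dm S) \<noteq> k" if "S \<in> cl T" for S
        using that ss_vertex[OF 0] 0 by auto
      then have "Poly_Mapping.keys z = {}"
        using z unfolding cellular_chain_def by blast
      then show ?thesis by simp
    qed
    then show "\<exists>w. cellular_chain (cl T) (k + 1) w \<and> cellular_boundary w = z"
      by (intro exI[of _ 0]) simp
  qed
next
  case (Suc m)
  let ?B = "body (ss T)"
  note db = downclosed_ss[of T]
  have topdim: "z = 0" if "cellular_chain (ss T) (int m + 1) z" for z
  proof -
    have "int (dm S) \<noteq> int m + 1" if "S \<in> ss T" for S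
      using dm_ss[OF that] Suc by simp
    then have "Poly_Mapping.keys z = {}"
      using that unfolding cellular_chain_def by blast
    then show ?thesis by simp
  qed
  have reduced: "reduced_cycle p ?B (to_singular p z)"
    if "cellular_chain (ss T) (int p) z" "cellular_boundary z = 0" "p = 0 \<longrightarrow> augmentation z = 0" for p z
    using singular_chain_to_singular[OF db that(1)] chain_boundary_to_singular[OF db that(1)] augmentation_to_singular_0[OF db, of z] that
    by (cases p) (simp_all add: reduced_cycle_def)
  have fill: "\<exists>w. cellular_chain (ss T) (int p + 1) w \<and> cellular_boundary w = z"
    if z: "cellular_chain (ss T) (int p) z" "cellular_boundary z = 0" and b: "bounds p ?B (to_singular p z)" for p z
  proof -
    obtain t where t: "singular_chain (Suc p) ?B t" "chain_boundary (Suc p) t = to_singular p z"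
      using b unfolding bounds_def by blast
    obtain w where "cellular_chain (ss T) (int (Suc p)) w" "cellular_boundary w = z"
      by (rule comparisonD[OF cmp t(1), of z]) (use z t(2) in simp_all)
    then show ?thesis by (intro exI[of _ w]) (simp add: add.commute)
  qed
  obtain g where g: "reduced_cycle m ?B g"
    "\<And>c. reduced_cycle m ?B c \<Longrightarrow> \<exists>j. bounds m ?B (c - frag_cmul j g)"
    "\<And>j. bounds m ?B (frag_cmul j g) \<Longrightarrow> j = 0"
    by (rule reduced_homology_generator[OF reduced_homology_boundary_sphere(1)[OF T Suc]]) blast
  obtain w t where w: "cellular_chain (ss T) (int m) w" "cellular_boundary w = 0"
    and t: "singular_chain (Suc m) ?B t" "g = to_singular m w + chain_boundary (Suc m) t"
    by (rule comparisonD[OF cmp, of m g 0]) (use g(1) in \<open>simp_all add: reduced_cycle_def\<close>)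
  have multiple: "\<exists>j. z = frag_cmul j w"
    if z: "cellular_chain (ss T) (int m) z" "cellular_boundary z = 0" "m = 0 \<longrightarrow> augmentation z = 0" for z
  proof -
    obtain j where "bounds m ?B (to_singular m z - frag_cmul j g)"
      using g(2)[OF reduced[OF z]] by blast
    then obtain t' where t': "singular_chain (Suc m) ?B t'"
      "chain_boundary (Suc m) t' = to_singular m z - frag_cmul j g"
      unfolding bounds_def by blast
    have "bounds m ?B (to_singular m (z - frag_cmul j w))"
      unfolding bounds_def
    proof (intro exI conjI)
      show "singular_chain (Suc m) ?B (t' + frag_cmul j t)"
        using t'(1) t(1) by (intro singular_chain_add singular_chain_cmul)
      show "chain_boundary (Suc m) (t' + frag_cmul j t) = to_singular m (z - frag_cmul j w)"
        by (simp add: chain_boundary_add chain_boundary_cmul t'(2) t(2) frag_cmul_distrib2)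
    qed
    moreover have "cellular_chain (ss T) (int m) (z - frag_cmul j w)"
      using z(1) w(1) by (intro cellular_chain_diff cellular_chain_cmul)
    moreover have "cellular_boundary (z - frag_cmul j w) = 0"
      by (simp add: z(2) w(2))
    ultimately obtain w' where "cellular_chain (ss T) (int m + 1) w'" "cellular_boundary w' = z - frag_cmul j w"
      using fill by blast
    then have "z - frag_cmul j w = 0"
      using topdim[of w'] by (metis cellular_boundary_simps(1))
    then show ?thesis by auto
  qed
  have bdT: "cellular_chain (ss T) (int m) (cell_boundary T)"
    using cellular_chain_cell_boundary[OF T] Suc by simp
  obtain j where j: "cell_boundary T = frag_cmul j w"
    using multiple[OF bdT cellular_boundary_cell_boundary[OF T]] augmentation_cell_boundary[OF T] Suc by auto
  have "w \<noteq> 0"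
  proof
    assume "w = 0"
    then have "bounds m ?B (frag_cmul 1 g)"
      using t unfolding bounds_def by auto
    then show False using g(3)[of 1] by simp
  qed
  then obtain S where S: "S \<in> Poly_Mapping.keys w"
    by (metis ex_in_conv keys_eq_empty)
  then have "S \<in> ss T" "dm T = Suc (dm S)"
    using w(1) Suc by (auto simp: cellular_chain_def)
  then have "j * Poly_Mapping.lookup w S = 1 \<or> j * Poly_Mapping.lookup w S = -1"
    using orient_unit[of S T] lookup_cell_boundary[OF T, of S] by (simp add: j)
  then have jj: "j * j = 1"
    by (metis minus_mult_minus mult_1 mult_minus_right zmult_eq_1_iff)
  show ?thesis
    unfolding acyclic_def
  proof (intro allI impI, elim conjE)
    fix k z assume z: "cellular_chain (cl T) k z" "cellular_boundary z = 0" and augmentation: "k = 0 \<longrightarrow> augmentation z = 0"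
    show "\<exists>u. cellular_chain (cl T) (k + 1) u \<and> cellular_boundary u = z"
    proof (cases "k = int (Suc m)")
      case True
      have keys: "Poly_Mapping.keys z \<subseteq> {T}"
        using z(1) True dm_ss Suc by (fastforce simp: cellular_chain_def)
      have zT: "z = frag_cmul (Poly_Mapping.lookup z T) (frag_of T)"
        using keys by (intro poly_mapping_eqI) (auto simp: in_keys_iff)
      have "frag_cmul (Poly_Mapping.lookup z T) (cell_boundary T) = 0"
        using z(2) by (subst (asm) zT) simp
      moreover have "cell_boundary T \<noteq> 0"
        using j jj \<open>w \<noteq> 0\<close> by auto
      ultimately have "z = 0"
        using zT by simp
      then show ?thesis by (intro exI[of _ 0]) simp
    next
      case False
      then have zb: "cellular_chain (ss T) k z"
        using z(1) Suc by (auto simp: cellular_chain_def)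
      show ?thesis
      proof (cases "k < 0")
        case True
        then show ?thesis
          using cellular_chain_neg[OF z(1)] by (intro exI[of _ 0]) simp
      next
        case False
        then obtain p where p: "k = int p" using nonneg_int_cases[of k] by auto
        show ?thesis
        proof (cases "p = m")
          case True
          then obtain i where i: "z = frag_cmul i w"
            using multiple[of z] zb z(2) augmentation p by auto
          show ?thesis
          proof (intro exI conjI)
            show "cellular_chain (cl T) (k + 1) (frag_cmul (i * j) (frag_of T))"
              using p True Suc by (intro cellular_chain_cmul) (simp add: cellular_chain_of)
            show "cellular_boundary (frag_cmul (i * j) (frag_of T)) = z"
              using jj by (simp add: j i mult.assoc)
          qed
        next
          case False
          have "reduced_cycle p ?B (to_singular p z)"
            using reduced[of p z] zb z(2) augmentation p by simp
          then have "bounds p ?B (to_singular p z)"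
            using reduced_cycle_bounds_if_trivial reduced_homology_boundary_sphere(2)[OF T Suc False]
            by blast
          then obtain u where "cellular_chain (ss T) (k + 1) u" "cellular_boundary u = z"
            using fill[of p z] zb z(2) p by auto
          then show ?thesis
            using cellular_chain_mono[of "ss T"] by blast
        qed
      qed
    qed
  qed
qed

lemma downclosed_remove_top:
  assumes "finite L" "downclosed L" "L \<noteq> {}"
  obtains T M where "T \<notin> M" "L = insert T M" "downclosed M" "ss T \<subseteq> M"
proof -
  have "Max (dm ` L) \<in> dm ` L"
    using assms(1,3) by (intro Max_in) auto
  then obtain T where T: "T \<in> L" and max: "dm T = Max (dm ` L)"
    by (metis imageE)
  have le: "dm S \<le> dm T" if "S \<in> L" for S
    unfolding max using assms(1) that by (intro Max_ge) auto
  show thesis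
  proof
    show "T \<notin> L - {T}" "L = insert T (L - {T})"
      using T by auto
    show "downclosed (L - {T})"
      unfolding downclosed_def
    proof (intro conjI ballI)
      show "L - {T} \<subseteq> cells K"
        using assms(2) by (auto simp: downclosed_def)
      fix S assume S: "S \<in> L - {T}"
      then have "ss S \<subseteq> L" using assms(2) by (auto simp: downclosed_def)
      moreover have "T \<notin> ss S"
        using dm_ss[of T S] le[of S] S by auto
      ultimately show "ss S \<subseteq> L - {T}" by auto
    qed
    show "ss T \<subseteq> L - {T}"
      using assms(2) T ssD by (auto simp: downclosed_def)
  qed
qed

text \<open>A cell \<open>T\<close> of maximal dimension is removed. The boundary \<open>\<partial>T\<close> is contained in what remains, so the
  induction applies to both, and it gives the acyclicity of \<open>T\<close> on the way.\<close>
lemma comparison_downclosed: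
  "\<lbrakk>finite L; downclosed L\<rbrakk> \<Longrightarrow> comparison L"
proof (induction "card L" arbitrary: L rule: less_induct)
  case less
  show ?case
  proof (cases "L = {}")
    case True
    show ?thesis
      unfolding comparison_def
    proof (intro allI impI, elim conjE)
      fix p s z assume "singular_chain p (body L) s" "cellular_chain L (int p - 1) z"
      then have "s = 0" "z = 0"
        using True by (auto simp: singular_chain_empty cellular_chain_def)
      then show "\<exists>w t. cellular_chain L (int p) w \<and> singular_chain (Suc p) (body L) t \<and>
          cellular_boundary w = z \<and> s = to_singular p w + chain_boundary (Suc p) t"
        by (intro exI[of _ 0]) simp
    qed
  next
    case False
    obtain T M where TM: "T \<notin> M" and L: "L = insert T M" and dM: "downclosed M" and "ss T \<subseteq> M"
      by (rule downclosed_remove_top[OF less.prems False])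
    have T: "T \<in> cells K"
      using less.prems(2) L by (auto simp: downclosed_def)
    have fM: "finite M" and card: "card M < card L"
      using less.prems(1) TM by (simp_all add: L)
    have "card (ss T) < card L"
      using card_mono[OF fM \<open>ss T \<subseteq> M\<close>] card by simp
    then have cb: "comparison (ss T)"
      using less.hyps downclosed_ss finite_ss[OF T] by blast
    have "comparison (cl T)"
      using comparison_cell[OF T acyclic_if_comparison_boundary[OF T cb]] .
    moreover have "comparison M"
      using less.hyps[OF card fM dM] .
    ultimately have "comparison (insert T M)"
      using comparison_insert[OF T TM \<open>ss T \<subseteq> M\<close> fM dM _ cb] by simp
    then show ?thesis
      by (simp only: L)
  qed
qed

lemma cell_acyclic: "T \<in> cells K \<Longrightarrow> acyclic T"
  using acyclic_if_comparison_boundary comparison_downclosed finite_ss downclosed_ss by blast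

section \<open>Cellular cochains of a cell\<close>
definition pairing :: "('p set \<Rightarrow> real) \<Rightarrow> ('p set \<Rightarrow>\<^sub>0 int) \<Rightarrow> real" where
  "pairing f z = (\<Sum>S\<in>Poly_Mapping.keys z. of_int (Poly_Mapping.lookup z S) * f S)"

definition coboundary :: "('p set \<Rightarrow> real) \<Rightarrow> 'p set \<Rightarrow> real" where
  "coboundary f T = (\<Sum>S\<in>ss T. of_int (orient K T S) * f S)"

lemma pairing_superset:
  assumes "finite I" "Poly_Mapping.keys z \<subseteq> I"
  shows "pairing f z = (\<Sum>S\<in>I. of_int (Poly_Mapping.lookup z S) * f S)"
  unfolding pairing_def using assms by (intro sum.mono_neutral_left) (auto simp: in_keys_iff)

lemma pairing_simps [simp]:
  "pairing f 0 = 0" "pairing f (frag_of S) = f S" "pairing f (a - b) = pairing f a - pairing f b"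
proof -
  let ?I = "Poly_Mapping.keys a \<union> Poly_Mapping.keys b"
  have "pairing f (a - b) = (\<Sum>S\<in>?I. of_int (Poly_Mapping.lookup (a - b) S) * f S)"
    using keys_diff[of a b] by (intro pairing_superset) auto
  also have "\<dots> = (\<Sum>S\<in>?I. of_int (Poly_Mapping.lookup a S) * f S)
      - (\<Sum>S\<in>?I. of_int (Poly_Mapping.lookup b S) * f S)"
    by (simp add: lookup_minus left_diff_distrib sum_subtractf)
  also have "\<dots> = pairing f a - pairing f b"
    using pairing_superset[of ?I a f] pairing_superset[of ?I b f] by simp
  finally show "pairing f (a - b) = pairing f a - pairing f b" .
qed (simp_all add: pairing_def)

lemma pairing_extend: "pairing f (frag_extend g z) = pairing (\<lambda>S. pairing f (g S)) z"
  using subset_UNIV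
  by (induction z rule: frag_induction) (simp_all add: frag_extend_diff)

lemma pairing_cell_boundary:
  assumes "T \<in> cells K" shows "pairing f (cell_boundary T) = coboundary f T"
proof -
  have "Poly_Mapping.keys (cell_boundary T) \<subseteq> ss T"
    using cellular_chain_cell_boundary[OF assms] by (auto simp: cellular_chain_def)
  then have "pairing f (cell_boundary T) = (\<Sum>S\<in>ss T. of_int (Poly_Mapping.lookup (cell_boundary T) S) * f S)"
    by (rule pairing_superset[OF finite_ss[OF assms]])
  also have "\<dots> = coboundary f T"
    by (simp add: coboundary_def lookup_cell_boundary[OF assms])
  finally show ?thesis .
qed

lemma coboundary_coboundary: assumes "T \<in> cells K" shows "coboundary (coboundary f) T = 0"
proof -
  have "coboundary (coboundary f) T = (\<Sum>S\<in>ss T. of_int (orient K T S) * pairing f (cell_boundary S))"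
    unfolding coboundary_def[of "coboundary f"] using pairing_cell_boundary ssD by (intro sum.cong) auto
  also have "\<dots> = pairing (\<lambda>S. pairing f (cell_boundary S)) (cell_boundary T)"
    by (simp add: pairing_cell_boundary[OF assms] coboundary_def)
  also have "\<dots> = pairing f (cellular_boundary (cell_boundary T))"
    by (simp add: cellular_boundary_def pairing_extend)
  finally show ?thesis by (simp add: cellular_boundary_cell_boundary[OF assms])
qed

lemma pairing_boundary_zero:
  assumes "L \<subseteq> cells K" "cellular_chain L k z" "\<And>S. \<lbrakk>S \<in> L; int (dm S) = k\<rbrakk> \<Longrightarrow> coboundary f S = 0"
  shows "pairing f (cellular_boundary z) = 0"
  using assms(2)
proof (induction rule: cellular_chain_induct)
  case (cell T)
  then show ?case using assms(1,3) by (auto simp: pairing_cell_boundary)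
qed simp_all

text \<open>A chain homotopy from the identity to the projection onto the vertex \<open>v\<close>. It is chosen on the
  cells, one dimension after the other, and composition with it gives primitives of cocycles.\<close>
primrec contraction :: "'p set \<Rightarrow> 'p set \<Rightarrow> nat \<Rightarrow> 'p set \<Rightarrow> ('p set \<Rightarrow>\<^sub>0 int)" where
  "contraction T v 0 S = (SOME w. cellular_chain (cl T) 1 w \<and> cellular_boundary w = frag_of S - frag_of v)"
| "contraction T v (Suc k) S = (SOME w. cellular_chain (cl T) (int k + 2) w \<and>
     cellular_boundary w = frag_of S - frag_extend (contraction T v k) (cell_boundary S))"

lemma contraction_0:
  assumes T: "T \<in> cells K" and v: "v \<in> cl T" "dm v = 0" and S: "S \<in> cl T" "dm S = 0"
  shows "cellular_chain (cl T) 1 (contraction T v 0 S) \<and>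
    cellular_boundary (contraction T v 0 S) = frag_of S - frag_of v"
proof -
  have "cellular_chain (cl T) 0 (frag_of S - frag_of v)"
    using v S by (intro cellular_chain_diff) (simp_all add: cellular_chain_of)
  moreover have "cellular_boundary (frag_of S - frag_of v) = 0"
    using v S by (simp add: cell_boundary_vertex)
  moreover have "augmentation (frag_of S - frag_of v) = 0" by simp
  ultimately have "\<exists>w. cellular_chain (cl T) 1 w \<and> cellular_boundary w = frag_of S - frag_of v"
    using cell_acyclic[OF T] unfolding acyclic_def by (metis add_0)
  from someI_ex[OF this] show ?thesis by simp
qed

lemma contraction_Suc:
  assumes T: "T \<in> cells K" and v: "v \<in> cl T" "dm v = 0"
  shows "\<lbrakk>S \<in> cl T; dm S = Suc k\<rbrakk> \<Longrightarrow> cellular_chain (cl T) (int k + 2) (contraction T v (Suc k) S) \<and>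
    cellular_boundary (contraction T v (Suc k) S) = frag_of S - frag_extend (contraction T v k) (cell_boundary S)"
proof (induction k arbitrary: S)
  case 0
  have S: "S \<in> cells K" using T ssD "0.prems"(1) by blast
  let ?c = "frag_extend (contraction T v 0) (cell_boundary S)"
  have bdS: "cellular_chain (cl T) 0 (cell_boundary S)"
    using cellular_chain_cellular_boundary[OF downclosed_cl[OF T], of 1 "frag_of S"] "0.prems"
    by (simp add: cellular_chain_of)
  have c: "cellular_chain (cl T) 1 ?c"
    using bdS by (rule cellular_chain_extend) (use contraction_0[OF T v] in simp)
  have "cellular_boundary (frag_extend (contraction T v 0) z) = z - frag_cmul (augmentation z) (frag_of v)"
    if "cellular_chain (cl T) 0 z" for z
    using that
    by (induction rule: cellular_chain_induct)
      (use contraction_0[OF T v] in \<open>simp_all add: frag_extend_diff frag_cmul_diff_distrib del: contraction.simps\<close>)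
  from this[OF bdS] have "cellular_boundary (frag_of S - ?c) = 0"
    using augmentation_cell_boundary[OF S] "0.prems" by (simp del: contraction.simps)
  moreover have "cellular_chain (cl T) 1 (frag_of S - ?c)"
    using c "0.prems" by (intro cellular_chain_diff) (simp_all add: cellular_chain_of)
  ultimately have "\<exists>w. cellular_chain (cl T) (1 + 1) w \<and> cellular_boundary w = frag_of S - ?c"
    using cell_acyclic[OF T] unfolding acyclic_def by (metis one_neq_zero)
  then have "\<exists>w. cellular_chain (cl T) (int 0 + 2) w \<and> cellular_boundary w = frag_of S - ?c" by simp
  from someI_ex[OF this] show ?case
    unfolding contraction.simps(2) .
next
  case (Suc k)
  have S: "S \<in> cells K" using T ssD Suc.prems(1) by blast
  let ?c = "frag_extend (contraction T v (Suc k)) (cell_boundary S)"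
  have bdS: "cellular_chain (cl T) (int (Suc k)) (cell_boundary S)"
    using cellular_chain_cellular_boundary[OF downclosed_cl[OF T], of "int (Suc (Suc k))" "frag_of S"] Suc.prems
    by (simp add: cellular_chain_of)
  have c: "cellular_chain (cl T) (int k + 2) ?c"
    using bdS by (rule cellular_chain_extend) (use Suc.IH in simp)
  have "cellular_boundary (frag_extend (contraction T v (Suc k)) z) = z - frag_extend (contraction T v k) (cellular_boundary z)"
    if "cellular_chain (cl T) (int (Suc k)) z" for z
    using that
    by (induction rule: cellular_chain_induct)
      (use Suc.IH in \<open>simp_all add: frag_extend_diff del: contraction.simps\<close>)
  from this[OF bdS] have "cellular_boundary (frag_of S - ?c) = 0"
    using cellular_boundary_cell_boundary[OF S] by (simp del: contraction.simps)
  moreover have "cellular_chain (cl T) (int k + 2) (frag_of S - ?c)"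
    using c Suc.prems by (intro cellular_chain_diff) (simp_all add: cellular_chain_of)
  moreover have "int k + 2 \<noteq> 0" by simp
  ultimately have "\<exists>w. cellular_chain (cl T) (int k + 2 + 1) w \<and> cellular_boundary w = frag_of S - ?c"
    using cell_acyclic[OF T] unfolding acyclic_def by blast
  then have "\<exists>w. cellular_chain (cl T) (int (Suc k) + 2) w \<and> cellular_boundary w = frag_of S - ?c"
    by (simp add: add.commute add.left_commute)
  from someI_ex[OF this] show ?case
    unfolding contraction.simps(2)[of T v "Suc k"] .
qed

text \<open>Evaluate \<open>f\<close> on \<open>S = \<partial>hS + h\<partial>S\<close>, where \<open>h\<close> is the contraction: the first term gives 0, the second is
  the coboundary of \<open>f \<circ> h\<close>.\<close>
lemma cocycle_is_coboundary:
  assumes T: "T \<in> cells K" and f: "\<And>S. \<lbrakk>S \<in> cl T; dm S = Suc (Suc k)\<rbrakk> \<Longrightarrow> coboundary f S = 0"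
  obtains g where "\<And>S. \<lbrakk>S \<in> cl T; dm S = Suc k\<rbrakk> \<Longrightarrow> f S = coboundary g S"
proof -
  obtain v where v: "v \<in> cl T" "dm v = 0"
    by (rule vertex_exists[OF T])
  have cells: "cl T \<subseteq> cells K"
    using downclosed_cl[OF T] by (simp add: downclosed_def)
  have "f S = coboundary (\<lambda>R. pairing f (contraction T v k R)) S" if S: "S \<in> cl T" "dm S = Suc k" for S
  proof -
    let ?w = "contraction T v (Suc k) S"
    have w: "cellular_chain (cl T) (int k + 2) ?w"
      and bw: "cellular_boundary ?w = frag_of S - frag_extend (contraction T v k) (cell_boundary S)"
      using contraction_Suc[OF T v S] by auto
    have "pairing f (cellular_boundary ?w) = 0"
      by (rule pairing_boundary_zero[OF cells w]) (simp add: f)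
    then have "f S = pairing f (frag_extend (contraction T v k) (cell_boundary S))"
      by (simp add: bw del: contraction.simps)
    also have "\<dots> = coboundary (\<lambda>R. pairing f (contraction T v k R)) S"
      using pairing_cell_boundary[of S] cells S(1) unfolding pairing_extend by blast
    finally show ?thesis .
  qed
  then show thesis by (rule that)
qed

lemma cocycle_constant:
  assumes T: "T \<in> cells K" and f: "\<And>S. \<lbrakk>S \<in> cl T; dm S = 1\<rbrakk> \<Longrightarrow> coboundary f S = 0"
    and v: "v \<in> cl T" "dm v = 0" and S: "S \<in> cl T" "dm S = 0"
  shows "f S = f v"
proof -
  have w: "cellular_chain (cl T) 1 (contraction T v 0 S)"
    "cellular_boundary (contraction T v 0 S) = frag_of S - frag_of v"
    using contraction_0[OF T v S] by auto
  have cells: "cl T \<subseteq> cells K"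
    using downclosed_cl[OF T] by (simp add: downclosed_def)
  have "pairing f (cellular_boundary (contraction T v 0 S)) = 0"
    by (rule pairing_boundary_zero[OF cells w(1)]) (simp add: f)
  then show ?thesis
    by (simp add: w(2) del: contraction.simps)
qed

end

section \<open>Finite element systems with extensions\<close>

lemma linear_map_on_diff:
  assumes "linear_map_on V W f" "subspace V" "x \<in> V" "y \<in> V"
  shows "f (x - y) = f x - f y"
proof -
  have "f (x + (-1) *\<^sub>R y) = f x + (-1) *\<^sub>R f y"
    using assms unfolding linear_map_on_def by (metis subspace_scale)
  then show ?thesis by simp
qed

lemma linear_map_on_0: "\<lbrakk>linear_map_on V W f; subspace V\<rbrakk> \<Longrightarrow> f 0 = 0"
  using linear_map_on_diff[of V W f 0 0] subspace_0 by fastforce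

lemma linear_map_on_add: "\<lbrakk>linear_map_on V W f; x \<in> V; y \<in> V\<rbrakk> \<Longrightarrow> f (x + y) = f x + f y"
  by (simp add: linear_map_on_def)

lemma linear_map_on_scale: "\<lbrakk>linear_map_on V W f; x \<in> V\<rbrakk> \<Longrightarrow> f (a *\<^sub>R x) = a *\<^sub>R f x"
  by (simp add: linear_map_on_def)

lemma linear_map_on_in: "\<lbrakk>linear_map_on V W f; x \<in> V\<rbrakk> \<Longrightarrow> f x \<in> W"
  by (auto simp: linear_map_on_def)

locale extension_system = cell_complex K for K :: "'p cell_cplx" +
  fixes A :: "('p, 'v::real_vector) fe_system"
  assumes system: "finite_element_system K A"
    and nondegenerate: "nondegenerate_at_points K A"
    and extensions: "admits_extensions K A"
begin

abbreviation V where "V \<equiv> sp A"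
abbreviation d where "d \<equiv> diff A"
abbreviation r where "r \<equiv> restr A"
abbreviation c where "c \<equiv> const A"
abbreviation e where "e \<equiv> eval A"

lemma complexes: "system_of_complexes K A" and constants: "constants_maps K A"
  and evaluations: "evaluation_maps K A"
  using system by (auto simp: finite_element_system_def)

lemma subspace_V: "T \<in> cells K \<Longrightarrow> subspace (V T k)"
  using complexes by (simp add: system_of_complexes_def)

lemmas V_0 = subspace_0[OF subspace_V]
lemmas V_add = subspace_add[OF subspace_V]
lemmas V_diff = subspace_diff[OF subspace_V]

lemma V_neg: "\<lbrakk>T \<in> cells K; k < 0; u \<in> V T k\<rbrakk> \<Longrightarrow> u = 0"
  using complexes by (auto simp: system_of_complexes_def)

lemma d_linear: "T \<in> cells K \<Longrightarrow> linear_map_on (V T k) (V T (k + 1)) (d T k)"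
  using complexes by (simp add: system_of_complexes_def)

lemma d_in: "\<lbrakk>T \<in> cells K; u \<in> V T (k - 1)\<rbrakk> \<Longrightarrow> d T (k - 1) u \<in> V T k"
  using linear_map_on_in[OF d_linear[of T "k - 1"]] by simp

lemma d_d: "\<lbrakk>T \<in> cells K; u \<in> V T (k - 1)\<rbrakk> \<Longrightarrow> d T k (d T (k - 1) u) = 0"
proof -
  assume "T \<in> cells K" "u \<in> V T (k - 1)"
  then have "d T (k - 1 + 1) (d T (k - 1) u) = 0"
    using complexes unfolding system_of_complexes_def by blast
  then show ?thesis by simp
qed

lemmas d_0 = linear_map_on_0[OF d_linear subspace_V]
lemmas d_add = linear_map_on_add[OF d_linear]
lemmas d_diff = linear_map_on_diff[OF d_linear subspace_V]

lemma r_linear: "\<lbrakk>T \<in> cells K; S \<in> cl T\<rbrakk> \<Longrightarrow> linear_map_on (V T k) (V S k) (r S T k)"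
  using complexes unfolding system_of_complexes_def by (metis subcell_iff)

lemmas r_in = linear_map_on_in[OF r_linear]
lemmas r_0 = linear_map_on_0[OF r_linear subspace_V]
lemmas r_add = linear_map_on_add[OF r_linear]
lemmas r_diff = linear_map_on_diff[OF r_linear subspace_V]

lemma r_d:
  "\<lbrakk>T \<in> cells K; S \<in> cl T; u \<in> V T (k - 1)\<rbrakk> \<Longrightarrow> r S T k (d T (k - 1) u) = d S (k - 1) (r S T (k - 1) u)"
proof -
  assume "T \<in> cells K" "S \<in> cl T" "u \<in> V T (k - 1)"
  moreover from this have "subcell K S T" by (simp add: subcell_iff)
  ultimately have "r S T (k - 1 + 1) (d T (k - 1) u) = d S (k - 1) (r S T (k - 1) u)"
    using complexes unfolding system_of_complexes_def by blast
  then show ?thesis by simp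
qed

lemma r_id: "\<lbrakk>T \<in> cells K; u \<in> V T k\<rbrakk> \<Longrightarrow> r T T k u = u"
  using complexes by (simp add: system_of_complexes_def)

lemma r_r:
  assumes "T \<in> cells K" "S \<in> cl T" "R \<in> cl S" "u \<in> V T k"
  shows "r R S k (r S T k u) = r R T k u"
proof -
  have "subcell K S T" "subcell K R S"
    using assms ssD by (auto simp: subcell_iff)
  then show ?thesis
    using complexes assms(4) unfolding system_of_complexes_def by metis
qed

lemma c_linear: "T \<in> cells K \<Longrightarrow> linear_map_on UNIV (V T 0) (c T)"
  using constants by (simp add: constants_maps_def)

lemma c_in: "T \<in> cells K \<Longrightarrow> c T a \<in> V T 0"
  using linear_map_on_in[OF c_linear] by blast

lemma d_c: "T \<in> cells K \<Longrightarrow> d T 0 (c T a) = 0"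
  using constants by (simp add: constants_maps_def)

lemma r_c: "\<lbrakk>T \<in> cells K; S \<in> cl T\<rbrakk> \<Longrightarrow> r S T 0 (c T a) = c S a"
  using constants unfolding constants_maps_def by (metis subcell_iff)

lemma e_linear: "\<lbrakk>T \<in> cells K; int (dm T) = k\<rbrakk> \<Longrightarrow> linear_map_on (V T k) UNIV (e T)"
  using evaluations by (auto simp: evaluation_maps_def)

lemmas e_0 = linear_map_on_0[OF e_linear subspace_V]
lemmas e_add = linear_map_on_add[OF e_linear]
lemmas e_diff = linear_map_on_diff[OF e_linear subspace_V]

lemma stokes:
  "\<lbrakk>T \<in> cells K; int (dm T) = k; u \<in> V T (k - 1)\<rbrakk> \<Longrightarrow>
     e T (d T (k - 1) u) = coboundary (\<lambda>S. e S (r S T (k - 1) u)) T"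
  using evaluations unfolding evaluation_maps_def coboundary_def by blast

lemma coboundary_cong: "(\<And>S. S \<in> ss T \<Longrightarrow> int (dm S) = int (dm T) - 1 \<Longrightarrow> f S = g S) \<Longrightarrow> coboundary f T = coboundary g T"
proof -
  assume eq: "\<And>S. S \<in> ss T \<Longrightarrow> int (dm S) = int (dm T) - 1 \<Longrightarrow> f S = g S"
  have "of_int (orient K T S) * f S = of_int (orient K T S) * g S" if "S \<in> ss T" for S
    using eq[OF that] orient_nonzero[OF that] by (cases "orient K T S = 0") auto
  then show ?thesis
    unfolding coboundary_def by (rule sum.cong[OF refl])
qed

lemma coboundary_simps:
  "coboundary (\<lambda>S. f S + g S) T = coboundary f T + coboundary g T" "coboundary (\<lambda>S. f S - g S) T = coboundary f T - coboundary g T"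
  "coboundary (\<lambda>S. - f S) T = - coboundary f T" "coboundary (\<lambda>S. 0) T = 0"
  by (simp_all add: coboundary_def sum.distrib sum_subtractf sum_negf distrib_left right_diff_distrib)

text \<open>The elements of \<open>A\<^sup>k(L)\<close>. Values outside \<open>L\<close> are arbitrary.\<close>
definition family :: "'p set set \<Rightarrow> int \<Rightarrow> ('p set \<Rightarrow> 'v) \<Rightarrow> bool" where
  "family L k u \<longleftrightarrow> (\<forall>T\<in>L. u T \<in> V T k \<and> (\<forall>S\<in>ss T. u S = r S T k (u T)))"

lemma family_zero: "downclosed L \<Longrightarrow> family L k (\<lambda>_. 0)"
  unfolding family_def downclosed_def using V_0 r_0 by (metis insertI2 subsetD)

lemma family_mono: "\<lbrakk>family L k u; M \<subseteq> L\<rbrakk> \<Longrightarrow> family M k u"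
  unfolding family_def by blast

lemma family_of_element:
  assumes T: "T \<in> cells K" and u: "u \<in> V T k" shows "family (cl T) k (\<lambda>S. r S T k u)"
  unfolding family_def
proof (intro ballI conjI)
  fix S assume S: "S \<in> cl T"
  show "r S T k u \<in> V S k" by (rule r_in[OF T S u])
  fix R assume "R \<in> ss S"
  then show "r R T k u = r R S k (r S T k u)"
    using r_r[OF T S _ u] by simp
qed

lemma family_determined:
  assumes T: "T \<in> cells K" and u: "family (cl T) k u" and S: "S \<in> cl T"
  shows "u S = r S T k (u T)"
  using assms r_id[OF T, of "u T" k] by (auto simp: family_def)

lemma mem_sp0: "u \<in> sp0 K A T k \<longleftrightarrow> u \<in> V T k \<and> (\<forall>S\<in>ss T. r S T k u = 0)"
  by (auto simp: sp0_def bdry_restr_def fun_eq_iff restrict_def)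

lemma extend_from_boundary:
  assumes T: "T \<in> cells K" and u: "family (ss T) k u"
  obtains w where "w \<in> V T k" "\<And>S. S \<in> ss T \<Longrightarrow> r S T k w = u S"
proof -
  let ?u = "restrict u (ss T)"
  have "?u \<in> bdry_sp K A T k"
    unfolding bdry_sp_def
  proof (intro CollectI conjI ballI allI impI)
    show "?u \<in> (\<Pi>\<^sub>E S\<in>ss T. V S k)"
      using u by (auto simp: family_def)
    fix S R assume S: "S \<in> ss T" and "subcell K R S"
    then have R: "R \<in> cl S" using ssD by (simp add: subcell_iff)
    have "u R = r R S k (u S)"
      using R u S r_id[of S "u S" k] ssD[OF S] by (auto simp: family_def)
    moreover have "R \<in> ss T" using R S ss_trans by blast
    ultimately show "?u R = r R S k (?u S)" using S by simp
  qed
  then obtain w where w: "w \<in> V T k" "?u = bdry_restr K A T k w"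
    using extensions T unfolding admits_extensions_def by blast
  have "r S T k w = u S" if "S \<in> ss T" for S
    using fun_cong[OF w(2), of S] that by (simp add: bdry_restr_def)
  then show thesis using that w(1) by blast
qed

section \<open>The de Rham map\<close>

text \<open>Exactness of the mapping cone of the de Rham map from families over \<open>L\<close> to real cellular cochains
  of \<open>L\<close>: a closed family whose evaluations form the coboundary of \<open>f\<close> has a primitive whose evaluations
  represent \<open>f\<close> up to a coboundary.\<close>
definition de_rham :: "'p set set \<Rightarrow> bool" where
  "de_rham L \<longleftrightarrow> (\<forall>k u f. family L k u \<and> (\<forall>T\<in>L. d T k (u T) = 0) \<and>
     (\<forall>T\<in>L. int (dm T) = k \<longrightarrow> e T (u T) = coboundary f T) \<longrightarrow>
     (\<exists>v g. family L (k - 1) v \<and> (\<forall>T\<in>L. d T (k - 1) (v T) = u T) \<and>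
        (\<forall>T\<in>L. int (dm T) = k - 1 \<longrightarrow> f T = e T (v T) + coboundary g T)))"

text \<open>The same for the subcomplex of elements with vanishing boundary values, where the only cell is \<open>T\<close>
  and a cochain is a number \<open>a\<close> in degree \<open>dim T\<close>.\<close>
definition de_rham0 :: "'p set \<Rightarrow> bool" where
  "de_rham0 T \<longleftrightarrow> (\<forall>k u a. u \<in> sp0 K A T k \<and> d T k u = 0 \<and> (int (dm T) = k \<longrightarrow> e T u = 0) \<longrightarrow>
     (\<exists>v\<in>sp0 K A T (k - 1). d T (k - 1) v = u \<and> (int (dm T) = k - 1 \<longrightarrow> e T v = a)))"

lemma de_rhamD:
  assumes "de_rham L" "family L k u" "\<And>T. T \<in> L \<Longrightarrow> d T k (u T) = 0"
    "\<And>T. \<lbrakk>T \<in> L; int (dm T) = k\<rbrakk> \<Longrightarrow> e T (u T) = coboundary f T"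
  obtains v g where "family L (k - 1) v" "\<And>T. T \<in> L \<Longrightarrow> d T (k - 1) (v T) = u T"
    "\<And>T. \<lbrakk>T \<in> L; int (dm T) = k - 1\<rbrakk> \<Longrightarrow> f T = e T (v T) + coboundary g T"
proof -
  have "\<exists>v g. family L (k - 1) v \<and> (\<forall>T\<in>L. d T (k - 1) (v T) = u T) \<and>
        (\<forall>T\<in>L. int (dm T) = k - 1 \<longrightarrow> f T = e T (v T) + coboundary g T)"
    using assms(1)[unfolded de_rham_def, rule_format, of k u f] assms(2-4) by blast
  then show thesis using that by blast
qed

lemma stokes_restricted:
  assumes "T \<in> cells K" "int (dm T) = k" "w \<in> V T (k - 1)" "\<And>S. S \<in> ss T \<Longrightarrow> r S T (k - 1) w = v S"
  shows "e T (d T (k - 1) w) = coboundary (\<lambda>S. e S (v S)) T"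
  unfolding stokes[OF assms(1-3)] by (rule coboundary_cong) (simp add: assms(4))

text \<open>A primitive over \<open>L\<close> extends to an element \<open>w\<close> of \<open>A(T)\<close>. The defect of \<open>w\<close> from being a primitive on
  \<open>T\<close> has vanishing boundary values, and the Stokes formula shows that it meets the hypothesis of the cone
  condition on \<open>A\<^sub>0(T)\<close>; its solution corrects \<open>w\<close>.\<close>
lemma de_rham_insert:
  assumes T: "T \<in> cells K" "T \<notin> L" "ss T \<subseteq> L" and L: "downclosed L"
    and drL: "de_rham L" and dr0: "de_rham0 T"
  shows "de_rham (insert T L)"
  unfolding de_rham_def
proof (intro allI impI, elim conjE)
  fix k u f
  let ?M = "insert T L"
  assume u: "family ?M k u" and du: "\<forall>S\<in>?M. d S k (u S) = 0"
    and eu: "\<forall>S\<in>?M. int (dm S) = k \<longrightarrow> e S (u S) = coboundary f S"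
  obtain v g where v: "family L (k - 1) v" and dv: "\<And>S. S \<in> L \<Longrightarrow> d S (k - 1) (v S) = u S"
    and ev: "\<And>S. \<lbrakk>S \<in> L; int (dm S) = k - 1\<rbrakk> \<Longrightarrow> f S = e S (v S) + coboundary g S"
    by (rule de_rhamD[OF drL family_mono[OF u], of f]) (use du eu in auto)
  obtain w where w: "w \<in> V T (k - 1)" and rw: "\<And>S. S \<in> ss T \<Longrightarrow> r S T (k - 1) w = v S"
    by (rule extend_from_boundary[OF T(1) family_mono[OF v T(3)]]) blast
  have uT: "u T \<in> V T k" using u by (simp add: family_def)
  have dw: "d T (k - 1) w \<in> V T k" by (rule d_in[OF T(1) w])
  let ?y = "u T - d T (k - 1) w"
  have "r S T k ?y = 0" if S: "S \<in> ss T" for S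
  proof -
    have "r S T k ?y = r S T k (u T) - r S T k (d T (k - 1) w)"
      using S uT dw by (intro r_diff[OF T(1)]) (auto intro: T(1))
    also have "r S T k (u T) = u S"
      using u S by (simp add: family_def)
    also have "r S T k (d T (k - 1) w) = u S"
      using r_d[OF T(1) _ w] S rw[OF S] dv T(3) by (simp add: subset_iff)
    finally show ?thesis by simp
  qed
  then have "?y \<in> sp0 K A T k"
    using V_diff[OF T(1) uT dw] by (simp add: mem_sp0)
  moreover have "d T k ?y = 0"
    using d_diff[OF T(1) T(1) uT dw] d_d[OF T(1) w] du by simp
  moreover have "e T ?y = 0" if k: "int (dm T) = k"
  proof -
    have "coboundary f T = coboundary (\<lambda>S. e S (v S) + coboundary g S) T"
      using ev T(3) k by (intro coboundary_cong) auto
    also have "\<dots> = e T (d T (k - 1) w)"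
      using stokes_restricted[OF T(1) k w rw] coboundary_coboundary[OF T(1), of g] by (simp add: coboundary_simps)
    finally show ?thesis
      using e_diff[OF T(1) k T(1) uT dw] eu k by simp
  qed
  ultimately obtain z where z: "z \<in> sp0 K A T (k - 1)" "d T (k - 1) z = ?y"
    and ez: "int (dm T) = k - 1 \<Longrightarrow> e T z = f T - e T w - coboundary g T"
    using dr0 unfolding de_rham0_def by meson
  have zV: "z \<in> V T (k - 1)" and rz: "\<And>S. S \<in> ss T \<Longrightarrow> r S T (k - 1) z = 0"
    using z(1) by (auto simp: mem_sp0)
  define v' where "v' = v(T := w + z)"
  have v'L: "v' S = v S" if "S \<in> L" for S using that T(2) by (auto simp: v'_def)
  have v'T: "v' T = w + z" by (simp add: v'_def)
  have ssL: "R \<in> L" if "S \<in> L" "R \<in> ss S" for S R using that L by (auto simp: downclosed_def)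
  show "\<exists>v g. family ?M (k - 1) v \<and> (\<forall>S\<in>?M. d S (k - 1) (v S) = u S) \<and>
        (\<forall>S\<in>?M. int (dm S) = k - 1 \<longrightarrow> f S = e S (v S) + coboundary g S)"
  proof (intro exI conjI)
    show "family ?M (k - 1) v'"
      unfolding family_def
    proof (intro ballI)
      fix S assume S: "S \<in> ?M"
      show "v' S \<in> V S (k - 1) \<and> (\<forall>R\<in>ss S. v' R = r R S (k - 1) (v' S))"
      proof (cases "S = T")
        case True
        have "v' R = r R T (k - 1) (w + z)" if R: "R \<in> ss T" for R
        proof -
          have "r R T (k - 1) (w + z) = r R T (k - 1) w + r R T (k - 1) z"
            using R w zV by (intro r_add[OF T(1)]) auto
          then show ?thesis using rw[OF R] rz[OF R] v'L[of R] R T(3) by auto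
        qed
        then show ?thesis
          using V_add[OF T(1) w zV] True v'T by simp
      next
        case False
        then have "S \<in> L" using S by simp
        then show ?thesis
          using v ssL v'L by (simp add: family_def)
      qed
    qed
    show "\<forall>S\<in>?M. d S (k - 1) (v' S) = u S"
      using dv v'L v'T d_add[OF T(1) w zV] z(2) by simp
    show "\<forall>S\<in>?M. int (dm S) = k - 1 \<longrightarrow> f S = e S (v' S) + coboundary g S"
      using ev v'L v'T e_add[OF T(1) _ w zV] ez by simp
  qed
qed

lemma de_rham_downclosed:
  "\<lbrakk>finite L; downclosed L; \<And>T. T \<in> L \<Longrightarrow> de_rham0 T\<rbrakk> \<Longrightarrow> de_rham L"
proof (induction "card L" arbitrary: L rule: less_induct)
  case less
  show ?case
  proof (cases "L = {}")
    case True
    then show ?thesis by (simp add: de_rham_def family_def)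
  next
    case False
    obtain T M where "T \<notin> M" and L: "L = insert T M" and "downclosed M" "ss T \<subseteq> M"
      by (rule downclosed_remove_top[OF less.prems(1,2) False])
    moreover have "card M < card L"
      using less.prems(1) \<open>T \<notin> M\<close> by (simp add: L)
    moreover have "T \<in> cells K"
      using less.prems(2) L by (auto simp: downclosed_def)
    ultimately show ?thesis
      using less.hyps[of M] less.prems(1,3) de_rham_insert[of T M] by simp
  qed
qed

text \<open>The primitive on the closed cell, obtained for the cochain with value \<open>a\<close> on \<open>T\<close> and \<open>0\<close> elsewhere,
  need not vanish on \<open>\<partial>T\<close>. But there it is closed with exact evaluations, so it has a primitive on \<open>\<partial>T\<close>,
  and subtracting the differential of an extension of the latter makes it vanish.\<close>
lemma de_rham0_if_de_rham:
  assumes T: "T \<in> cells K" and drT: "de_rham (cl T)" and drb: "de_rham (ss T)"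
  shows "de_rham0 T"
  unfolding de_rham0_def
proof (intro allI impI, elim conjE)
  fix k u a
  assume u: "u \<in> sp0 K A T k" and du: "d T k u = 0" and eu: "int (dm T) = k \<longrightarrow> e T u = 0"
  have uV: "u \<in> V T k" and ru: "\<And>S. S \<in> ss T \<Longrightarrow> r S T k u = 0"
    using u by (auto simp: mem_sp0)
  have T_ss: "T \<notin> ss T" using ssD by blast
  let ?f = "\<lambda>S. if S = T then a else 0 :: real"
  have coboundary_f: "coboundary ?f S = 0" if "S \<in> cl T" for S
  proof -
    have "T \<notin> ss S" using that dm_ss[of T S] dm_ss[of S T] by auto
    then have "coboundary ?f S = coboundary (\<lambda>_. 0) S" by (intro coboundary_cong) auto
    then show ?thesis by (simp add: coboundary_simps)
  qed
  have 1: "d S k (r S T k u) = 0" if "S \<in> cl T" for S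
    using that r_id[OF T uV] du ru d_0[of S k] ssD[of S T] by auto
  have 2: "e S (r S T k u) = coboundary ?f S" if "S \<in> cl T" "int (dm S) = k" for S
    using that coboundary_f[OF that(1)] r_id[OF T uV] eu ru e_0[of S k] ssD[of S T] by auto
  obtain v g where v: "family (cl T) (k - 1) v"
    and dv: "\<And>S. S \<in> cl T \<Longrightarrow> d S (k - 1) (v S) = r S T k u"
    and ev: "\<And>S. \<lbrakk>S \<in> cl T; int (dm S) = k - 1\<rbrakk> \<Longrightarrow> ?f S = e S (v S) + coboundary g S"
    by (rule de_rhamD[OF drT family_of_element[OF T uV] 1 2]) blast+
  have 3: "d S (k - 1) (v S) = 0" if "S \<in> ss T" for S
    using dv[of S] ru that by simp
  have 4: "e S (v S) = coboundary (\<lambda>R. - g R) S" if "S \<in> ss T" "int (dm S) = k - 1" for S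
  proof -
    have "S \<noteq> T" using that(1) T_ss by blast
    then have "0 = e S (v S) + coboundary g S" using ev[of S] that by simp
    then show ?thesis by (simp add: coboundary_simps)
  qed
  obtain v2 g2 where v2: "family (ss T) (k - 1 - 1) v2"
    and dv2: "\<And>S. S \<in> ss T \<Longrightarrow> d S (k - 1 - 1) (v2 S) = v S"
    and ev2: "\<And>S. \<lbrakk>S \<in> ss T; int (dm S) = k - 1 - 1\<rbrakk> \<Longrightarrow> - g S = e S (v2 S) + coboundary g2 S"
    by (rule de_rhamD[OF drb family_mono[OF v] 3 4]) blast+
  obtain w where w: "w \<in> V T (k - 1 - 1)" and rw: "\<And>S. S \<in> ss T \<Longrightarrow> r S T (k - 1 - 1) w = v2 S"
    by (rule extend_from_boundary[OF T v2]) blast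
  have vT: "v T \<in> V T (k - 1)" and rv: "\<And>S. S \<in> ss T \<Longrightarrow> r S T (k - 1) (v T) = v S"
    using v by (simp_all add: family_def)
  have dw: "d T (k - 1 - 1) w \<in> V T (k - 1)" by (rule d_in[OF T w])
  let ?z = "v T - d T (k - 1 - 1) w"
  show "\<exists>z\<in>sp0 K A T (k - 1). d T (k - 1) z = u \<and> (int (dm T) = k - 1 \<longrightarrow> e T z = a)"
  proof (intro bexI[of _ ?z] conjI impI)
    have "r S T (k - 1) ?z = 0" if S: "S \<in> ss T" for S
    proof -
      have "r S T (k - 1) ?z = r S T (k - 1) (v T) - r S T (k - 1) (d T (k - 1 - 1) w)"
        using S vT dw by (intro r_diff[OF T]) (auto intro: T)
      then show ?thesis
        using r_d[OF T _ w] S rw[OF S] dv2[OF S] rv[OF S] by simp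
    qed
    then show "?z \<in> sp0 K A T (k - 1)"
      using V_diff[OF T vT dw] by (simp add: mem_sp0)
    show "d T (k - 1) ?z = u"
      using d_diff[OF T T vT dw] d_d[OF T w] dv[of T] r_id[OF T uV] by simp
    assume k: "int (dm T) = k - 1"
    have "coboundary (\<lambda>S. - g S) T = coboundary (\<lambda>S. e S (v2 S) + coboundary g2 S) T"
      using ev2 k by (intro coboundary_cong) auto
    then have "e T (d T (k - 1 - 1) w) = - coboundary g T"
      using stokes_restricted[OF T k w rw] coboundary_coboundary[OF T, of g2] by (simp add: coboundary_simps)
    then show "e T ?z = a"
      using e_diff[OF T k T vT dw] ev[of T] k by simp
  qed
qed

section \<open>Exactness on a closed cell\<close>

text \<open>On an edge the Stokes formula for a constant reads \<open>0 = e d c = \<delta>(e c)\<close>. So the evaluations of a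
  constant at the vertices form a cocycle, and this is constant on a cell.\<close>
lemma vertex_value:
  assumes T: "T \<in> cells K" and v: "v \<in> cl T" "dm v = 0" and S: "S \<in> cl T" "dm S = 0"
  shows "e S (c S a) = a * e v (c v 1)"
proof -
  have cells: "R \<in> cells K" if "R \<in> cl T" for R using T that ssD by blast
  have "coboundary (\<lambda>R. e R (c R a)) E = 0" if E: "E \<in> cl T" "dm E = 1" for E
  proof -
    have "c E a \<in> V E (1 - 1)" using c_in[OF cells[OF E(1)]] by simp
    moreover have "r R E (1 - 1) (c E a) = c R a" if "R \<in> ss E" for R
      using r_c[OF cells[OF E(1)], of R] that by simp
    ultimately have "e E (d E (1 - 1) (c E a)) = coboundary (\<lambda>R. e R (c R a)) E"
      using E(2) by (intro stokes_restricted[OF cells[OF E(1)]]) auto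
    then show ?thesis
      using d_c[OF cells[OF E(1)]] e_0[OF cells[OF E(1)] _ cells[OF E(1)]] E(2) by simp
  qed
  then have "e S (c S a) = e v (c v a)"
    by (rule cocycle_constant[OF T _ v S])
  also have "c v a = a *\<^sub>R c v 1"
    using linear_map_on_scale[OF c_linear[OF cells[OF v(1)]], of 1 a] by simp
  also have "e v (a *\<^sub>R c v 1) = a * e v (c v 1)"
    using linear_map_on_scale[OF e_linear[OF cells[OF v(1)]], of 0 "c v 1" a] v(2)
      c_in[OF cells[OF v(1)]] by simp
  finally show ?thesis .
qed

lemma vertex_value_nonzero: "\<lbrakk>T \<in> cells K; v \<in> cl T; dm v = 0\<rbrakk> \<Longrightarrow> e v (c v 1) \<noteq> 0"
  using nondegenerate ssD unfolding nondegenerate_at_points_def by blast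

lemma coboundary_vertex: "dm v = 0 \<Longrightarrow> coboundary f v = 0"
  by (simp add: coboundary_def ss_vertex)

definition exact_on :: "'p set \<Rightarrow> bool" where
  "exact_on T \<longleftrightarrow> inj (c T) \<and> range (c T) = {u \<in> V T 0. d T 0 u = 0} \<and>
     (\<forall>k\<ge>0. d T k ` V T k = {u \<in> V T (k + 1). d T (k + 1) u = 0})"

lemma locally_exact_iff: "locally_exact K A \<longleftrightarrow> (\<forall>T\<in>cells K. exact_on T)"
  by (simp add: locally_exact_def exact_on_def)

text \<open>A closed element of positive degree has a primitive \<open>w\<close>, and \<open>f\<close> minus the evaluations of \<open>w\<close> is a
  cocycle on \<open>T\<close>. If it has positive degree, it is a coboundary; in degree 0 it is constant, and a
  constant added to \<open>w\<close> absorbs it. A closed element of degree 0 is a constant with vanishing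
  evaluation at a vertex, so it is zero.\<close>
lemma de_rham_if_exact:
  assumes T: "T \<in> cells K" and ex: "exact_on T"
  shows "de_rham (cl T)"
  unfolding de_rham_def
proof (intro allI impI, elim conjE)
  fix k u f
  assume u: "family (cl T) k u" and du: "\<forall>S\<in>cl T. d S k (u S) = 0"
    and eu: "\<forall>S\<in>cl T. int (dm S) = k \<longrightarrow> e S (u S) = coboundary f S"
  have cells: "S \<in> cells K" if "S \<in> cl T" for S using T that ssD by blast
  have uS: "u S = r S T k (u T)" if "S \<in> cl T" for S
    using family_determined[OF T u that] .
  have uT: "u T \<in> V T k" "d T k (u T) = 0" using u du by (simp_all add: family_def)
  obtain v where v: "v \<in> cl T" "dm v = 0" by (rule vertex_exists[OF T])
  let ?goal = "\<exists>v g. family (cl T) (k - 1) v \<and> (\<forall>S\<in>cl T. d S (k - 1) (v S) = u S) \<and>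
        (\<forall>S\<in>cl T. int (dm S) = k - 1 \<longrightarrow> f S = e S (v S) + coboundary g S)"
  consider "k \<le> 0" | "1 \<le> k" by linarith
  then show ?goal
  proof cases
    case 1
    have "u T = 0"
    proof (cases "k = 0")
      case True
      obtain a where a: "u T = c T a"
        using ex uT True unfolding exact_on_def by blast
      have "u v = c v a" using uS[OF v(1)] r_c[OF T v(1)] a True by simp
      then have "a * e v (c v 1) = 0"
        using eu v vertex_value[OF T v v, of a] coboundary_vertex[OF v(2)] True by auto
      then have "a = 0" using vertex_value_nonzero[OF T v] by simp
      then show ?thesis using a linear_map_on_0[OF c_linear[OF T]] by simp
    qed (use V_neg[OF T _ uT(1)] 1 in simp)
    then have "u S = 0" if "S \<in> cl T" for S
      using uS[OF that] r_0[OF T that T] by simp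
    then show ?goal
      using family_zero[OF downclosed_cl[OF T]] d_0[OF cells cells] 1
      by (intro exI[of _ "\<lambda>_. 0"]) auto
  next
    case 2
    have "u T \<in> d T (k - 1) ` V T (k - 1)"
    proof -
      have "d T (k - 1) ` V T (k - 1) = {u \<in> V T (k - 1 + 1). d T (k - 1 + 1) u = 0}"
        using ex 2 unfolding exact_on_def by (metis diff_ge_0_iff_ge)
      then show ?thesis using uT by simp
    qed
    then obtain w where w: "w \<in> V T (k - 1)" "u T = d T (k - 1) w" by blast
    have dr: "d S (k - 1) (r S T (k - 1) w) = u S" if "S \<in> cl T" for S
      using uS[OF that] r_d[OF T that w(1)] w(2) by simp
    let ?f = "\<lambda>S. f S - e S (r S T (k - 1) w)"
    have cf: "coboundary ?f S = 0" if S: "S \<in> cl T" "int (dm S) = k" for S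
    proof -
      have "e S (d S (k - 1) (r S T (k - 1) w)) = coboundary (\<lambda>R. e R (r R T (k - 1) w)) S"
        using r_in[OF T S(1) w(1)] r_r[OF T S(1) _ w(1)]
        by (intro stokes_restricted[OF cells[OF S(1)] S(2)]) auto
      then have "e S (u S) = coboundary (\<lambda>R. e R (r R T (k - 1) w)) S"
        by (simp only: dr[OF S(1)])
      moreover have "e S (u S) = coboundary f S" using eu S by blast
      ultimately show ?thesis by (simp add: coboundary_simps)
    qed
    show ?goal
    proof (cases "k = 1")
      case True
      have const: "?f S = ?f v" if "S \<in> cl T" "dm S = 0" for S
        using cf True by (intro cocycle_constant[OF T _ v that]) simp
      let ?b = "?f v / e v (c v 1)"
      let ?w = "w + c T ?b"
      have cw: "c T ?b \<in> V T (k - 1)" using c_in[OF T] True by simp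
      have rw: "r S T (k - 1) ?w = r S T (k - 1) w + c S ?b" if "S \<in> cl T" for S
        using r_add[OF T that w(1) cw] r_c[OF T that] True by simp
      show ?goal
      proof (intro exI conjI ballI impI)
        show "family (cl T) (k - 1) (\<lambda>S. r S T (k - 1) ?w)"
          using family_of_element[OF T V_add[OF T w(1) cw]] .
        fix S assume S: "S \<in> cl T"
        have cS: "c S ?b \<in> V S (k - 1)" using c_in[OF cells[OF S]] True by simp
        show "d S (k - 1) (r S T (k - 1) ?w) = u S"
          unfolding rw[OF S]
          using d_add[OF cells[OF S] r_in[OF T S w(1)] cS] dr[OF S] d_c[OF cells[OF S]] True by simp
        assume dS: "int (dm S) = k - 1"
        have "e S (r S T (k - 1) ?w) = e S (r S T (k - 1) w) + e S (c S ?b)"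
          unfolding rw[OF S] using e_add[OF cells[OF S] dS r_in[OF T S w(1)] cS] .
        also have "e S (c S ?b) = ?f v"
          using vertex_value[OF T v S, of ?b] vertex_value_nonzero[OF T v] dS True by simp
        finally show "f S = e S (r S T (k - 1) ?w) + coboundary (\<lambda>_. 0) S"
          using const[OF S] dS True by (simp add: coboundary_simps)
      qed
    next
      case False
      then obtain j where j: "k = int (Suc (Suc j))"
        using 2 by (metis One_nat_def Suc_pred' nat_0_le int_one_le_iff_zero_less
            of_nat_1 linorder_not_less nat_le_0 not0_implies_Suc of_nat_0 zero_less_one order_trans zero_le_one)
      obtain g where g: "\<And>S. \<lbrakk>S \<in> cl T; dm S = Suc j\<rbrakk> \<Longrightarrow> ?f S = coboundary g S"
        by (rule cocycle_is_coboundary[OF T, of j ?f]) (use cf j in auto)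
      show ?goal
      proof (intro exI conjI ballI impI)
        show "family (cl T) (k - 1) (\<lambda>S. r S T (k - 1) w)"
          using family_of_element[OF T w(1)] .
        fix S assume S: "S \<in> cl T"
        show "d S (k - 1) (r S T (k - 1) w) = u S" by (rule dr[OF S])
        assume "int (dm S) = k - 1"
        then show "f S = e S (r S T (k - 1) w) + coboundary g S"
          using g[OF S] j by simp
      qed
    qed
  qed
qed

text \<open>The evaluations of a closed element form a cocycle on \<open>T\<close>. In positive degree this is a coboundary,
  and the cone condition gives a primitive. In degree 0 it is constant, hence equal to the evaluations
  of some \<open>c\<^sub>T(b)\<close>; the difference from \<open>c\<^sub>T(b)\<close> has a primitive in degree \<open>-1\<close>, so it vanishes.\<close>
lemma exact_if_de_rham:
  assumes T: "T \<in> cells K" and inj: "inj (c T)" and dr: "de_rham (cl T)"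
  shows "exact_on T"
proof -
  have cells: "S \<in> cells K" if "S \<in> cl T" for S using T that ssD by blast
  have primitive: "\<exists>w\<in>V T (k - 1). d T (k - 1) w = u"
    if u: "u \<in> V T k" "d T k u = 0" and f: "\<And>S. \<lbrakk>S \<in> cl T; int (dm S) = k\<rbrakk> \<Longrightarrow> e S (r S T k u) = coboundary f S"
    for k u f
  proof -
    have 1: "d S k (r S T k u) = 0" if S: "S \<in> cl T" for S
      using r_d[OF T S, of u "k + 1"] u r_0[OF T S T, of "k + 1"] by simp
    obtain v where "family (cl T) (k - 1) v" "\<And>S. S \<in> cl T \<Longrightarrow> d S (k - 1) (v S) = r S T k u"
      by (rule de_rhamD[OF dr family_of_element[OF T u(1)] 1 f]) blast+
    then show ?thesis
      using r_id[OF T u(1)] by (intro bexI[of _ "v T"]) (auto simp: family_def)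
  qed
  have closed: "coboundary (\<lambda>R. e R (r R T k u)) S = 0"
    if u: "u \<in> V T k" "d T k u = 0" and S: "S \<in> cl T" "int (dm S) = k + 1" for k u S
  proof -
    have "e S (d S (k + 1 - 1) (r S T k u)) = coboundary (\<lambda>R. e R (r R T k u)) S"
      using r_in[OF T S(1) u(1)] r_r[OF T S(1) _ u(1)]
      by (intro stokes_restricted[OF cells[OF S(1)] S(2)]) auto
    moreover have "d S k (r S T k u) = 0"
      using r_d[OF T S(1), of u "k + 1"] u r_0[OF T S(1) T, of "k + 1"] by simp
    ultimately show ?thesis
      using e_0[OF cells[OF S(1)] S(2) cells[OF S(1)]] by simp
  qed
  obtain v where v: "v \<in> cl T" "dm v = 0" by (rule vertex_exists[OF T])
  have "u \<in> range (c T)" if u: "u \<in> V T 0" "d T 0 u = 0" for u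
  proof -
    let ?b = "e v (r v T 0 u) / e v (c v 1)"
    have const: "e S (r S T 0 u) = e v (r v T 0 u)" if S: "S \<in> cl T" "dm S = 0" for S
      using closed[OF u] by (intro cocycle_constant[OF T _ v S]) simp
    let ?u = "u - c T ?b"
    have "e S (r S T 0 ?u) = coboundary (\<lambda>_. 0) S" if S: "S \<in> cl T" "int (dm S) = 0" for S
    proof -
      have "r S T 0 ?u = r S T 0 u - c S ?b"
        using r_diff[OF T S(1) T u(1) c_in[OF T]] r_c[OF T S(1)] by simp
      then have "e S (r S T 0 ?u) = e S (r S T 0 u) - e S (c S ?b)"
        using e_diff[OF cells[OF S(1)] S(2) cells[OF S(1)] r_in[OF T S(1) u(1)] c_in[OF cells[OF S(1)]]]
        by simp
      then show ?thesis
        using const[OF S(1)] S(2) vertex_value[OF T v S(1), of ?b] vertex_value_nonzero[OF T v]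
        by (simp add: coboundary_simps)
    qed
    moreover have "?u \<in> V T 0" by (rule V_diff[OF T u(1) c_in[OF T]])
    moreover have "d T 0 ?u = 0"
      using d_diff[OF T T u(1) c_in[OF T]] u(2) d_c[OF T] by simp
    ultimately obtain w where w: "w \<in> V T (0 - 1)" "d T (0 - 1) w = ?u"
      using primitive[of ?u 0 "\<lambda>_. 0"] by blast
    then have "w = 0" using V_neg[OF T _ w(1)] by simp
    then have "u = c T ?b" using w(2) d_0[OF T T, of "0 - 1"] by simp
    then show ?thesis by blast
  qed
  moreover have "u \<in> d T k ` V T k" if k: "0 \<le> k" and u: "u \<in> V T (k + 1)" "d T (k + 1) u = 0" for k u
  proof -
    obtain j where j: "k = int j" using k nonneg_int_cases by blast
    obtain f where "\<And>S. \<lbrakk>S \<in> cl T; dm S = Suc j\<rbrakk> \<Longrightarrow> e S (r S T (k + 1) u) = coboundary f S"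
      by (rule cocycle_is_coboundary[OF T, of j "\<lambda>S. e S (r S T (k + 1) u)"])
        (use closed[OF u] j in auto)
    then show ?thesis
      using primitive[OF u, of f] j by auto
  qed
  moreover have "d T k u \<in> V T (k + 1) \<and> d T (k + 1) (d T k u) = 0" if "u \<in> V T k" for k u
    using d_in[OF T, of u "k + 1"] d_d[OF T, of u "k + 1"] that by simp
  ultimately show ?thesis
    using inj c_in[OF T] d_c[OF T] unfolding exact_on_def by (auto simp: image_iff)
qed

section \<open>Cohomology with vanishing boundary values\<close>
lemma coboundaries0_cocycles0:
  assumes T: "T \<in> cells K" and y: "y \<in> coboundaries0 K A T k"
  shows "y \<in> cocycles0 K A T k" "int (dm T) = k \<Longrightarrow> e T y = 0"
proof -
  obtain x where x: "x \<in> V T (k - 1)" "\<And>S. S \<in> ss T \<Longrightarrow> r S T (k - 1) x = 0" "y = d T (k - 1) x"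
    using y by (auto simp: coboundaries0_def mem_sp0)
  have "r S T k y = 0" if S: "S \<in> ss T" for S
    using r_d[OF T _ x(1), of S] x(2,3) d_0[of S "k - 1"] ssD[OF S] S by simp
  then show "y \<in> cocycles0 K A T k"
    using d_in[OF T x(1)] d_d[OF T x(1)] x(3) by (simp add: cocycles0_def mem_sp0)
  assume k: "int (dm T) = k"
  have "e T y = coboundary (\<lambda>S. e S 0) T"
    unfolding x(3) by (rule stokes_restricted[OF T k x(1,2)])
  also have "\<dots> = coboundary (\<lambda>S. 0) T"
    using ssD k e_0 by (intro coboundary_cong) blast
  finally show "e T y = 0" by (simp add: coboundary_simps)
qed

lemma subspace_cocycles0: assumes T: "T \<in> cells K" shows "subspace (cocycles0 K A T k)"
proof -
  have "subspace {u \<in> V T k. (\<forall>S\<in>ss T. r S T k u = 0) \<and> d T k u = 0}"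
    unfolding subspace_def
  proof (intro conjI ballI allI)
    show "0 \<in> {u \<in> V T k. (\<forall>S\<in>ss T. r S T k u = 0) \<and> d T k u = 0}"
      using V_0[OF T] r_0[OF T _ T] d_0[OF T T] by simp
    fix x assume x: "x \<in> {u \<in> V T k. (\<forall>S\<in>ss T. r S T k u = 0) \<and> d T k u = 0}"
    show "a *\<^sub>R x \<in> {u \<in> V T k. (\<forall>S\<in>ss T. r S T k u = 0) \<and> d T k u = 0}" for a
      using x subspace_scale[OF subspace_V[OF T]] linear_map_on_scale[OF r_linear[OF T]]
        linear_map_on_scale[OF d_linear[OF T]] by simp
    fix y assume y: "y \<in> {u \<in> V T k. (\<forall>S\<in>ss T. r S T k u = 0) \<and> d T k u = 0}"
    show "x + y \<in> {u \<in> V T k. (\<forall>S\<in>ss T. r S T k u = 0) \<and> d T k u = 0}"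
      using x y V_add[OF T] r_add[OF T] d_add[OF T] by simp
  qed
  moreover have "cocycles0 K A T k = {u \<in> V T k. (\<forall>S\<in>ss T. r S T k u = 0) \<and> d T k u = 0}"
    by (auto simp: cocycles0_def mem_sp0)
  ultimately show ?thesis by simp
qed

lemma subspace_coboundaries0: assumes T: "T \<in> cells K" shows "subspace (coboundaries0 K A T k)"
  unfolding subspace_def
proof (intro conjI ballI allI)
  have sub: "subspace (sp0 K A T k)" for k
    unfolding subspace_def
    using V_0[OF T] r_0[OF T _ T] V_add[OF T] r_add[OF T] subspace_scale[OF subspace_V[OF T]]
      linear_map_on_scale[OF r_linear[OF T]] by (simp add: mem_sp0)
  have sp0V: "x \<in> V T k" if "x \<in> sp0 K A T k" for x k
    using that by (simp add: mem_sp0)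
  show "0 \<in> coboundaries0 K A T k"
    unfolding coboundaries0_def using d_0[OF T T, of "k - 1"] subspace_0[OF sub] by (metis image_eqI)
  fix x assume "x \<in> coboundaries0 K A T k"
  then obtain x' where x: "x' \<in> sp0 K A T (k - 1)" "x = d T (k - 1) x'"
    by (auto simp: coboundaries0_def)
  show "a *\<^sub>R x \<in> coboundaries0 K A T k" for a
    unfolding coboundaries0_def x(2)
    using linear_map_on_scale[OF d_linear[OF T] sp0V[OF x(1)], of a] subspace_scale[OF sub x(1), of a]
    by (metis image_eqI)
  fix y assume "y \<in> coboundaries0 K A T k"
  then obtain y' where y: "y' \<in> sp0 K A T (k - 1)" "y = d T (k - 1) y'"
    by (auto simp: coboundaries0_def)
  show "x + y \<in> coboundaries0 K A T k"
    unfolding coboundaries0_def x(2) y(2)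
    using d_add[OF T sp0V[OF x(1)] sp0V[OF y(1)]] subspace_add[OF sub x(1) y(1)]
    by (metis image_eqI)
qed

end

lemma quotient_trivial_iff:
  assumes "subspace Z" "subspace B" "B \<subseteq> Z"
  shows "Z // {(x, y). x \<in> Z \<and> y \<in> Z \<and> x - y \<in> B} = {B} \<longleftrightarrow> Z = B"
proof
  let ?R = "{(x, y). x \<in> Z \<and> y \<in> Z \<and> x - y \<in> B}"
  assume q: "Z // ?R = {B}"
  have "x \<in> B" if "x \<in> Z" for x
  proof -
    have "?R `` {x} \<in> Z // ?R" using that by (rule quotientI)
    then have "?R `` {x} = B" using q by simp
    moreover have "x \<in> ?R `` {x}" using that subspace_0[OF assms(2)] by simp
    ultimately show ?thesis by simp
  qed
  then show "Z = B" using assms(3) by blast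
next
  let ?R = "{(x, y). x \<in> Z \<and> y \<in> Z \<and> x - y \<in> B}"
  assume ZB: "Z = B"
  have "?R `` {x} = B" if "x \<in> Z" for x
    using that subspace_diff[OF assms(2)] unfolding ZB by auto
  moreover have "Z \<noteq> {}" using subspace_0[OF assms(1)] by blast
  ultimately show "Z // ?R = {B}" by (auto simp: quotient_def)
qed

text \<open>As \<open>f\<close> vanishes on \<open>B\<close>, its image of a class is a singleton, and the induced map is linear; so it is
  injective if and only if its kernel is trivial.\<close>
lemma bij_betw_quotient_iff:
  fixes f :: "'b::real_vector \<Rightarrow> real"
  assumes "subspace Z" "subspace B" "B \<subseteq> Z"
    and diff: "\<And>x y. \<lbrakk>x \<in> Z; y \<in> Z\<rbrakk> \<Longrightarrow> f (x - y) = f x - f y" and B: "\<And>x. x \<in> B \<Longrightarrow> f x = 0"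
  shows "bij_betw (\<lambda>C. the_elem (f ` C)) (Z // {(x, y). x \<in> Z \<and> y \<in> Z \<and> x - y \<in> B}) UNIV \<longleftrightarrow>
    (\<forall>x\<in>Z. f x = 0 \<longrightarrow> x \<in> B) \<and> (\<forall>a. \<exists>x\<in>Z. f x = a)"
proof -
  let ?R = "{(x, y). x \<in> Z \<and> y \<in> Z \<and> x - y \<in> B}"
  let ?F = "\<lambda>C. the_elem (f ` C)"
  have self: "x \<in> ?R `` {x}" if "x \<in> Z" for x
    using that subspace_0[OF assms(2)] by simp
  have F: "?F (?R `` {x}) = f x" if x: "x \<in> Z" for x
  proof -
    have "f ` (?R `` {x}) = {f x}"
      using self[OF x] diff[OF x] B x by fastforce
    then show ?thesis by simp
  qed
  have sym: "y - x \<in> B" if "x - y \<in> B" for x y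
    using subspace_neg[OF assms(2) that] by simp
  have cls: "?R `` {x} = ?R `` {y} \<longleftrightarrow> x - y \<in> B" if x: "x \<in> Z" and y: "y \<in> Z" for x y
  proof
    assume "?R `` {x} = ?R `` {y}"
    then have "y \<in> ?R `` {x}" using self[OF y] by simp
    then show "x - y \<in> B" by simp
  next
    assume xy: "x - y \<in> B"
    have "x - z \<in> B \<longleftrightarrow> y - z \<in> B" for z
      using subspace_diff[OF assms(2) _ xy, of "x - z"] subspace_add[OF assms(2) _ xy, of "y - z"]
      by auto
    then show "?R `` {x} = ?R `` {y}" using x y by auto
  qed
  have Q: "Z // ?R = (\<lambda>x. ?R `` {x}) ` Z" by (auto simp: quotient_def)
  have "bij_betw ?F (Z // ?R) UNIV \<longleftrightarrow>
      (\<forall>x\<in>Z. \<forall>y\<in>Z. f x = f y \<longrightarrow> x - y \<in> B) \<and> f ` Z = UNIV"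
  proof -
    have "inj_on ?F (Z // ?R) \<longleftrightarrow> (\<forall>x\<in>Z. \<forall>y\<in>Z. f x = f y \<longrightarrow> x - y \<in> B)"
      unfolding inj_on_def Q ball_simps using F cls by (metis (no_types, lifting))
    moreover have "?F ` (Z // ?R) = f ` Z"
      unfolding Q image_image using F by (rule image_cong[OF refl])
    ultimately show ?thesis by (simp add: bij_betw_def)
  qed
  also have "(\<forall>x\<in>Z. \<forall>y\<in>Z. f x = f y \<longrightarrow> x - y \<in> B) \<longleftrightarrow> (\<forall>x\<in>Z. f x = 0 \<longrightarrow> x \<in> B)"
  proof (intro iffI ballI impI)
    fix x assume h: "\<forall>x\<in>Z. \<forall>y\<in>Z. f x = f y \<longrightarrow> x - y \<in> B" and x: "x \<in> Z" "f x = 0"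
    have "f 0 = 0" using B subspace_0[OF assms(2)] by blast
    then show "x \<in> B" using h x subspace_0[OF assms(1)] by (metis diff_zero)
  next
    fix x y assume h: "\<forall>x\<in>Z. f x = 0 \<longrightarrow> x \<in> B" and xy: "x \<in> Z" "y \<in> Z" "f x = f y"
    then show "x - y \<in> B" using diff subspace_diff[OF assms(1)] by simp
  qed
  also have "f ` Z = UNIV \<longleftrightarrow> (\<forall>a. \<exists>x\<in>Z. f x = a)" by (auto simp: image_iff set_eq_iff; metis)
  finally show ?thesis .
qed

context extension_system
begin

text \<open>The cone condition in degree \<open>dim T\<close> is injectivity of the evaluation on cohomology. In degree
  \<open>dim T + 1\<close>, where \<open>a\<close> is arbitrary, it combines vanishing of the cohomology with surjectivity of the
  evaluation. In all other degrees it is vanishing of the cohomology.\<close>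
lemma cohomology_condition_iff:
  assumes T: "T \<in> cells K"
  shows "cohomology_condition K A T \<longleftrightarrow> de_rham0 T"
proof -
  let ?Z = "cocycles0 K A T" and ?B = "coboundaries0 K A T" and ?n = "int (dm T)"
  have BZ: "?B k \<subseteq> ?Z k" for k
    using coboundaries0_cocycles0(1)[OF T] by blast
  note Z = subspace_cocycles0[OF T] and B = subspace_coboundaries0[OF T]
  have ZV: "x \<in> V T k" if "x \<in> ?Z k" for x k
    using that by (simp add: cocycles0_def mem_sp0)
  have cond: "cohomology_condition K A T \<longleftrightarrow> (\<forall>k. k \<noteq> ?n \<longrightarrow> ?Z k = ?B k) \<and>
      (\<forall>x\<in>?Z ?n. e T x = 0 \<longrightarrow> x \<in> ?B ?n) \<and> (\<forall>a. \<exists>x\<in>?Z ?n. e T x = a)"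
  proof -
    have "cohomology0 K A T k = {?B k} \<longleftrightarrow> ?Z k = ?B k" for k
      unfolding cohomology0_def by (rule quotient_trivial_iff[OF Z B BZ])
    moreover have "bij_betw (eval_cohomology0 A T) (cohomology0 K A T ?n) UNIV \<longleftrightarrow>
        (\<forall>x\<in>?Z ?n. e T x = 0 \<longrightarrow> x \<in> ?B ?n) \<and> (\<forall>a. \<exists>x\<in>?Z ?n. e T x = a)"
      unfolding cohomology0_def eval_cohomology0_def[abs_def]
    proof (rule bij_betw_quotient_iff[OF Z B BZ])
      show "e T (x - y) = e T x - e T y" if "x \<in> ?Z ?n" "y \<in> ?Z ?n" for x y
        using e_diff[OF T refl T ZV[OF that(1)] ZV[OF that(2)]] .
      show "e T x = 0" if "x \<in> ?B ?n" for x
        using coboundaries0_cocycles0(2)[OF T that refl] .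
    qed
    ultimately show ?thesis
      unfolding cohomology_condition_def by simp
  qed
  have memB: "y \<in> ?B k \<longleftrightarrow> (\<exists>x\<in>sp0 K A T (k - 1). d T (k - 1) x = y)" for y k
    by (auto simp: coboundaries0_def)
  have memZ: "y \<in> ?Z k \<longleftrightarrow> y \<in> sp0 K A T k \<and> d T k y = 0" for y k
    by (simp add: cocycles0_def)
  show ?thesis
    unfolding cond
  proof (intro iffI conjI allI impI ballI)
    assume "de_rham0 T"
    then have dr: "\<exists>v\<in>sp0 K A T (k - 1). d T (k - 1) v = u \<and> (?n = k - 1 \<longrightarrow> e T v = a)"
      if "u \<in> ?Z k" "?n = k \<longrightarrow> e T u = 0" for k u a
      using that unfolding de_rham0_def memZ by blast
    show "?Z k = ?B k" if "k \<noteq> ?n" for k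
      using dr[of _ k 0] that BZ[of k] memB[of _ k] by blast
    show "x \<in> ?B ?n" if "x \<in> ?Z ?n" "e T x = 0" for x
      using dr[of x ?n 0] that memB[of x ?n] by blast
    show "\<exists>x\<in>?Z ?n. e T x = a" for a
      using dr[of 0 "?n + 1" a] subspace_0[OF Z] by (auto simp: memZ)
  next
    assume h: "(\<forall>k. k \<noteq> ?n \<longrightarrow> ?Z k = ?B k) \<and>
      (\<forall>x\<in>?Z ?n. e T x = 0 \<longrightarrow> x \<in> ?B ?n) \<and> (\<forall>a. \<exists>x\<in>?Z ?n. e T x = a)"
    show "de_rham0 T"
      unfolding de_rham0_def
    proof (intro allI impI, elim conjE)
      fix k u a
      assume u: "u \<in> sp0 K A T k" "d T k u = 0" and eu: "?n = k \<longrightarrow> e T u = 0"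
      have "u \<in> ?B k"
        using h u eu memZ by (cases "k = ?n") auto
      then obtain v where v: "v \<in> sp0 K A T (k - 1)" "d T (k - 1) v = u"
        using memB by blast
      show "\<exists>v\<in>sp0 K A T (k - 1). d T (k - 1) v = u \<and> (?n = k - 1 \<longrightarrow> e T v = a)"
      proof (cases "?n = k - 1")
        case False
        then show ?thesis using v by blast
      next
        case True
        obtain x where x: "x \<in> ?Z (k - 1)" "e T x = a - e T v"
          using h True by metis
        have vV: "v \<in> V T (k - 1)" and xV: "x \<in> V T (k - 1)"
          using v(1) ZV[OF x(1)] by (simp_all add: mem_sp0)
        have "v + x \<in> sp0 K A T (k - 1)"
          using v(1) x(1) V_add[OF T vV xV] r_add[OF T _ vV xV] by (auto simp: memZ mem_sp0)
        moreover have "d T (k - 1) (v + x) = u"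
          using d_add[OF T vV xV] v(2) x(1) by (simp add: memZ)
        moreover have "e T (v + x) = a"
          using e_add[OF T True vV xV] x(2) by simp
        ultimately show ?thesis by blast
      qed
    qed
  qed
qed

lemma finite_cl: "T \<in> cells K \<Longrightarrow> finite (cl T)"
  using finite_ss by simp

lemma exact_if_cohomology:
  assumes T: "T \<in> cells K" and inj: "inj (c T)"
    and coh: "\<And>S. S \<in> cells K \<Longrightarrow> cohomology_condition K A S"
  shows "exact_on T"
proof (rule exact_if_de_rham[OF T inj de_rham_downclosed[OF finite_cl[OF T] downclosed_cl[OF T]]])
  fix S assume "S \<in> cl T"
  then have "S \<in> cells K" using T ssD by blast
  then show "de_rham0 S" using coh cohomology_condition_iff by blast
qed

text \<open>By induction the cone condition holds on \<open>A\<^sub>0(S)\<close> for all strict subcells \<open>S\<close>, hence the de Rham map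
  of \<open>\<partial>T\<close> is a quasi-isomorphism; so is that of the closed cell, by exactness.\<close>
lemma cohomology_if_exact:
  assumes ex: "\<And>T. T \<in> cells K \<Longrightarrow> exact_on T"
  shows "T \<in> cells K \<Longrightarrow> cohomology_condition K A T"
proof (induction "dm T" arbitrary: T rule: less_induct)
  case less
  have "de_rham0 S" if "S \<in> ss T" for S
    using less.hyps[OF dm_ss[OF that]] cohomology_condition_iff ssD[OF that] by blast
  then have "de_rham (ss T)"
    by (rule de_rham_downclosed[OF finite_ss[OF less.prems] downclosed_ss])
  then show ?case
    using de_rham0_if_de_rham[OF less.prems de_rham_if_exact[OF less.prems ex[OF less.prems]]]
      cohomology_condition_iff[OF less.prems] by blast
qed

end

theorem theorem4p3:
  fixes K :: "'p cell_cplx" and A :: "('p, 'v::real_vector) fe_system"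
  assumes "cellular_complex K"
    and "finite_element_system K A"
    and "nondegenerate_at_points K A"
    and "admits_extensions K A"
  shows "compatible K A \<longleftrightarrow>
           (\<forall>T\<in>cells K. inj (const A T)) \<and> (\<forall>T\<in>cells K. cohomology_condition K A T)"
proof -
  interpret extension_system K A
    using assms by unfold_locales
  have "compatible K A \<longleftrightarrow> (\<forall>T\<in>cells K. exact_on T)"
    using assms(4) locally_exact_iff by (simp add: compatible_def)
  also have "\<dots> \<longleftrightarrow> (\<forall>T\<in>cells K. inj (const A T)) \<and> (\<forall>T\<in>cells K. cohomology_condition K A T)"
    using exact_if_cohomology cohomology_if_exact exact_on_def by blast
  finally show ?thesis .
qed

end
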